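(* Let $v=p_1^{r_1}\cdots p_a^{r_a}q_1^{s_1}\cdots q_b^{s_b}$, where $p_1,\dots,p_a,q_1,\dots,q_b$ are pairwise distinct primes, each $p_i$ satisfies $p_i\equiv 1\pmod 6$ or $p_i=3$, and each $q_i\equiv 2\pmod 3$. If some $s_i$ ($1\le i\le b$) is odd, then there is no distributive Mendelsohn quasigroup of order $v$.
   Context: A Mendelsohn quasigroup is an idempotent quasigroup $(V,\circ)$ satisfying $x\circ(y\circ x)=y$ for all $x,y\in V$. A quasigroup is distributive if it is both left distributive, $x\circ(y\circ z)=(x\circ y)\circ(x\circ z)$, and right distributive, $(x\circ y)\circ z=(x\circ z)\circ(y\circ z)$, for all $x,y,z$. *)

theory Defs
  imports "HOL-Number_Theory.Number_Theory"
begin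

locale quasigroup =
  fixes V :: "'a set" and comp :: "'a \<Rightarrow> 'a \<Rightarrow> 'a" (infixl "\<star>" 70)
  assumes closed: "x \<in> V \<Longrightarrow> y \<in> V \<Longrightarrow> x \<star> y \<in> V"
    and left_division: "x \<in> V \<Longrightarrow> z \<in> V \<Longrightarrow> \<exists>!y. y \<in> V \<and> x \<star> y = z"
    and right_division: "y \<in> V \<Longrightarrow> z \<in> V \<Longrightarrow> \<exists>!x. x \<in> V \<and> x \<star> y = z"

locale mendelsohn_quasigroup = quasigroup +
  assumes idempotent: "x \<in> V \<Longrightarrow> x \<star> x = x"
    and semisymmetric: "x \<in> V \<Longrightarrow> y \<in> V \<Longrightarrow> x \<star> (y \<star> x) = y"

locale distributive_quasigroup = quasigroup +
  assumes left_distributive: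
      "x \<in> V \<Longrightarrow> y \<in> V \<Longrightarrow> z \<in> V \<Longrightarrow> x \<star> (y \<star> z) = (x \<star> y) \<star> (x \<star> z)"
    and right_distributive:
      "x \<in> V \<Longrightarrow> y \<in> V \<Longrightarrow> z \<in> V \<Longrightarrow> (x \<star> y) \<star> z = (x \<star> z) \<star> (y \<star> z)"

locale distributive_mendelsohn_quasigroup = mendelsohn_quasigroup + distributive_quasigroup

end

theory Submission
  imports Defs "HOL-Algebra.Sylow" "HOL-Algebra.Group_Action" "HOL-Algebra.Generated_Groups"
begin

text \<open>
  In a distributive Mendelsohn quasigroup \<open>V\<close> the left translations \<open>L x\<close> are automorphisms, and the
  displacement group \<open>D\<close> generated by the \<open>L a (L b)\<inverse>\<close> is transitive. The key identity is that
  \<open>(L a)\<^sup>2 (L b)\<^sup>-\<^sup>2\<close> is central in \<open>D\<close>. Hence modulo the orbits of the centre \<open>Z\<close> of \<open>D\<close> all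
  \<open>(L a)\<^sup>2\<close> are trivial, so the quotient is a distributive Steiner quasigroup (a Hall triple system).
  The order of the latter is a power of 3 by the Baer--Suzuki theorem, because four of its points
  \<open>a, b, c, d\<close> satisfy that \<open>(L a L b L c L d)\<^sup>3\<close> fixes each of them. The group \<open>Z\<close> is abelian and
  acts semiregularly, so \<open>\<bar>V\<bar>\<close> is \<open>\<bar>Z\<bar>\<close> times a power of 3; and conjugation by a translation is
  an automorphism \<open>\<phi>\<close> of \<open>Z\<close> with \<open>\<phi>\<^sup>2 - \<phi> + 1 = 0\<close>, which forces every prime congruent to 2
  modulo 3 to occur with even exponent in \<open>\<bar>Z\<bar>\<close>.
\<close>

section \<open>The Baer--Suzuki theorem\<close>

text \<open>The obstacle is that \<open>V\<close> need not be affine over an abelian group: Hall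
  triple systems are themselves distributive Mendelsohn quasigroups and can fail to be medial. Only
  the orbits of \<open>Z\<close> carry a module structure, so the quotient has to be handled by
  group theory. An automorphism that fixes \<open>a\<close> commutes with \<open>L a\<close>; hence
  the cubes in question are central in the group generated by L a L b and L c L d, two elements with
  trivial cubes, and such a pair generates a 3-group. Baer-Suzuki is needed because this information
  concerns pairs only, while transitivity requires the group generated by all products of two
  translations. The relation for \<phi> is the law x(yx) = y read at a base point. It makes \<phi>^2
  a permutation of order dividing 3 that moves every nontrivial element of q-power order, so 3
  divides q^k - 1, although q = -1 modulo 3.\<close>

lemma prime_power_if_unique_prime_divisor:
  fixes m p :: nat
  assumes "m > 0" "\<And>q. prime q \<Longrightarrow> q dvd m \<Longrightarrow> q = p" "prime p"
  shows "\<exists>n. m = p ^ n"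
proof -
  have "prime_factors m \<subseteq> {p}"
    using assms by auto
  then have "m = (\<Prod>q\<in>{p}. q ^ multiplicity q m)"
    using assms(1,3) prime_factorization_nat[of m]
    by (subst prime_factorization_nat, simp) (rule prod.mono_neutral_left, auto simp: prime_factors_multiplicity)
  then show ?thesis by auto
qed

section \<open>Finite p-groups, described by the orders of their elements\<close>

context group
begin

text \<open>Stated through elements and not through the cardinality: passing to subgroups is then
  immediate, and a product of two subgroups can be treated by taking powers.
  \<open>p_subgroup_card\<close> recovers the order.\<close>

definition p_subgroup :: "nat \<Rightarrow> 'a set \<Rightarrow> bool" where
  "p_subgroup p H \<longleftrightarrow> subgroup H G \<and> (\<forall>x\<in>H. \<exists>k::nat. x [^] (p ^ k) = \<one>)"

lemma p_subgroup_subset: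
  assumes "p_subgroup p H" "subgroup K G" "K \<subseteq> H"
  shows "p_subgroup p K"
  using assms unfolding p_subgroup_def by blast

text \<open>Cauchy's theorem, taken from Sylow with exponent 1: a prime \<open>q\<close> dividing
  the order yields an element of order \<open>q\<close>, and this order divides a power of
  \<open>p\<close>.\<close>

lemma p_subgroup_card:
  assumes fin: "finite (carrier G)" and p: "prime p" and H: "p_subgroup p H"
  shows "\<exists>n. card H = p ^ n"
proof (rule prime_power_if_unique_prime_divisor[OF _ _ p])
  have sub: "subgroup H G" using H by (simp add: p_subgroup_def)
  have finH: "finite H" using sub fin subgroup.subset finite_subset by blast
  show "card H > 0" using finH subgroup.one_closed[OF sub] card_gt_0_iff by blast
  fix q assume q: "prime q" "q dvd card H"
  then obtain m where "card H = q ^ 1 * m" by (auto elim: dvdE)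
  interpret GH: group "G\<lparr>carrier := H\<rparr>" by (rule subgroup_imp_group[OF sub])
  obtain K where K: "subgroup K (G\<lparr>carrier := H\<rparr>)" "card K = q ^ 1"
    using sylow_thm[of q "G\<lparr>carrier := H\<rparr>" 1 m] q \<open>card H = q ^ 1 * m\<close> finH GH.is_group
    by (auto simp: order_def)
  have KG: "subgroup K G" and KH: "K \<subseteq> H"
    using K(1) sub incl_subgroup subgroup.subset by fastforce+
  obtain x where x: "x \<in> K" "x \<noteq> \<one>"
  proof -
    have "card K \<ge> 2" using K(2) q(1) prime_ge_2_nat by simp
    then have "\<not> K \<subseteq> {\<one>}" by (metis card_mono card.empty card_insert_disjoint finite.emptyI
        finite.insertI empty_iff not_less_eq_eq numeral_2_eq_2 One_nat_def)
    then show ?thesis using that by blast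
  qed
  interpret GK: group "G\<lparr>carrier := K\<rparr>" by (rule subgroup_imp_group[OF KG])
  have xG: "x \<in> carrier G" using x KG subgroup.subset by blast
  have "x [^]\<^bsub>G\<lparr>carrier := K\<rparr>\<^esub> order (G\<lparr>carrier := K\<rparr>) = \<one>"
    using GK.pow_order_eq_1[of x] x(1) by simp
  then have "x [^] q = \<one>" using K(2) by (simp add: order_def nat_pow_consistent[symmetric])
  then have d1: "ord x dvd q" using pow_eq_id xG by blast
  obtain k where "x [^] (p ^ k) = \<one>" using H x KH by (auto simp: p_subgroup_def)
  then have d2: "ord x dvd p ^ k" using pow_eq_id xG by blast
  have "ord x \<noteq> 1" using x(2) ord_eq_1 xG by blast
  then have "ord x = q" using d1 q(1) by (auto simp: prime_nat_iff)
  then have "q dvd p" using d2 q(1) prime_dvd_power by blast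
  then show "q = p" using q(1) p primes_dvd_imp_eq by blast
qed

lemma conj_l_r_coset:
  "g <# H #> inv g = (\<lambda>h. g \<otimes> h \<otimes> inv g) ` H"
  by (auto simp: l_coset_def r_coset_def)

text \<open>Since conjugation is only required to map \<open>A\<close> into itself, closure under
  inverses comes from finiteness: \<open>inv g\<close> is a power of \<open>g\<close>.\<close>

lemma subgroup_normalizing_elements:
  assumes fin: "finite (carrier G)" and A: "A \<subseteq> carrier G"
  shows "subgroup {g \<in> carrier G. \<forall>a\<in>A. g \<otimes> a \<otimes> inv g \<in> A} G" (is "subgroup ?N G")
proof -
  have mult: "g \<otimes> h \<in> ?N" if "g \<in> ?N" "h \<in> ?N" for g h
  proof -
    have "g \<otimes> h \<otimes> a \<otimes> inv (g \<otimes> h) = g \<otimes> (h \<otimes> a \<otimes> inv h) \<otimes> inv g" if "a \<in> A" for a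
      using that \<open>g \<in> ?N\<close> \<open>h \<in> ?N\<close> A by (auto simp: inv_mult_group m_assoc subset_iff)
    then show ?thesis using that by auto
  qed
  have one: "\<one> \<in> ?N" using A by auto
  show ?thesis
  proof (rule subgroupI)
    fix g assume g: "g \<in> ?N"
    have pow: "g [^] n \<in> ?N" for n :: nat
      by (induction n) (use one mult g in auto)
    have "inv g = g [^] (ord g - 1)"
    proof -
      have "g \<otimes> g [^] (ord g - 1) = g [^] ord g"
        using g fin ord_ge_1[of g] by (metis (no_types, lifting) Suc_diff_le diff_Suc_1 mem_Collect_eq nat_pow_Suc2 One_nat_def)
      then show ?thesis using g by (simp add: inv_equality inv_comm)
    qed
    then show "inv g \<in> ?N" using pow by (simp only:)
  qed (use mult one in auto)
qed

text \<open>Normalization gives \<open>(a \<otimes> b) [^] n = a' \<otimes> b [^] n\<close> with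
  \<open>a'\<close> in \<open>A\<close>. A power of \<open>p\<close> that kills \<open>b\<close>
  therefore leaves an element of \<open>A\<close>, which a further power kills.\<close>

lemma p_subgroup_mult:
  assumes A: "p_subgroup p A" and B: "p_subgroup p B"
    and norm: "\<And>a b. a \<in> A \<Longrightarrow> b \<in> B \<Longrightarrow> b \<otimes> a \<otimes> inv b \<in> A"
  shows "p_subgroup p (A <#> B)"
proof -
  have sA: "subgroup A G" and sB: "subgroup B G" using A B by (auto simp: p_subgroup_def)
  note [simp, intro] = subgroup.mem_carrier[OF sA] subgroup.mem_carrier[OF sB]
  note [intro] = subgroup.m_closed[OF sA] subgroup.m_closed[OF sB]
      subgroup.m_inv_closed[OF sA] subgroup.m_inv_closed[OF sB] norm
  have mul: "(a \<otimes> b) \<otimes> (a' \<otimes> b') = (a \<otimes> (b \<otimes> a' \<otimes> inv b)) \<otimes> (b \<otimes> b')"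
    if "a \<in> A" "b \<in> B" "a' \<in> A" "b' \<in> B" for a b a' b'
    using that by (simp add: m_assoc inv_solve_left)
  have pow: "\<exists>a'\<in>A. (a \<otimes> b) [^] n = a' \<otimes> b [^] n" if "a \<in> A" "b \<in> B" for a b and n :: nat
  proof (induction n)
    case 0
    then show ?case using subgroup.one_closed[OF sA] by auto
  next
    case (Suc n)
    then obtain a' where a': "a' \<in> A" "(a \<otimes> b) [^] n = a' \<otimes> b [^] n" by blast
    have bn: "b [^] n \<in> B"
      by (induction n) (use that(2) subgroup.one_closed[OF sB] in auto)
    have "(a \<otimes> b) [^] Suc n = (a' \<otimes> (b [^] n \<otimes> a \<otimes> inv (b [^] n))) \<otimes> b [^] Suc n"
      using mul[OF a'(1) bn that] a' by simp
    then show ?case using a' bn that by blast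
  qed
  have "subgroup (A <#> B) G"
  proof (rule subgroupI)
    show "A <#> B \<subseteq> carrier G" by (auto simp: set_mult_def)
    show "A <#> B \<noteq> {}" using subgroup.one_closed[OF sA] subgroup.one_closed[OF sB] by (auto simp: set_mult_def)
    fix x assume "x \<in> A <#> B"
    then obtain a b where x: "x = a \<otimes> b" "a \<in> A" "b \<in> B" by (auto simp: set_mult_def)
    have "inv b \<otimes> inv a \<otimes> inv (inv b) \<in> A" using x by blast
    moreover have "inv x = (inv b \<otimes> inv a \<otimes> inv (inv b)) \<otimes> inv b"
      using x by (simp add: inv_mult_group m_assoc)
    ultimately show "inv x \<in> A <#> B" using x unfolding set_mult_def by blast
    fix y assume "y \<in> A <#> B"
    then obtain a' b' where y: "y = a' \<otimes> b'" "a' \<in> A" "b' \<in> B" by (auto simp: set_mult_def)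
    have "a \<otimes> (b \<otimes> a' \<otimes> inv b) \<in> A" "b \<otimes> b' \<in> B" using x y by blast+
    then show "x \<otimes> y \<in> A <#> B" using mul[OF x(2,3) y(2,3)] unfolding set_mult_def x(1) y(1) by auto
  qed
  moreover have "\<exists>k. x [^] (p ^ k) = \<one>" if xAB: "x \<in> A <#> B" for x
  proof -
    obtain a b where x: "x = a \<otimes> b" "a \<in> A" "b \<in> B" using xAB by (auto simp: set_mult_def)
    obtain k where k: "b [^] (p ^ k) = \<one>" using B x by (auto simp: p_subgroup_def)
    obtain a' where a': "a' \<in> A" "x [^] (p ^ k) = a'" using pow[OF x(2,3), of "p ^ k"] k x by auto
    obtain j where "a' [^] (p ^ j) = \<one>" using A a' by (auto simp: p_subgroup_def)
    then have "x [^] (p ^ (k + j)) = \<one>" using a'(2) x by (simp add: power_add nat_pow_pow[symmetric])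
    then show ?thesis by blast
  qed
  ultimately show ?thesis by (simp add: p_subgroup_def)
qed

text \<open>The elements that conjugate \<open>generate G S\<close> into itself form a subgroup, so
  it is enough to test normalization on generators; the product of the two generated subgroups then
  contains both sets.\<close>

lemma p_subgroup_generate_Un:
  assumes fin: "finite (carrier G)" and S: "S \<subseteq> carrier G" and T: "T \<subseteq> carrier G"
    and pS: "p_subgroup p (generate G S)" and pT: "p_subgroup p (generate G T)"
    and norm: "\<And>s t. s \<in> S \<Longrightarrow> t \<in> T \<Longrightarrow> t \<otimes> s \<otimes> inv t \<in> generate G S"
  shows "p_subgroup p (generate G (S \<union> T))"
proof -
  let ?A = "generate G S"
  let ?N = "{g \<in> carrier G. \<forall>a\<in>?A. g \<otimes> a \<otimes> inv g \<in> ?A}"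
  have sA: "subgroup ?A G" by (rule generate_is_subgroup[OF S])
  have AG: "?A \<subseteq> carrier G" using sA subgroup.subset by blast
  have "T \<subseteq> ?N"
  proof
    fix t assume t: "t \<in> T"
    then have tG: "t \<in> carrier G" using T by blast
    have "t \<otimes> a \<otimes> inv t \<in> ?A" if "a \<in> ?A" for a
      using that
    proof (induction rule: generate.induct)
      case one
      then show ?case using tG generate.one by auto
    next
      case (incl h)
      then show ?case using norm t by blast
    next
      case (inv h)
      then have "t \<otimes> inv h \<otimes> inv t = inv (t \<otimes> h \<otimes> inv t)"
        using tG S by (auto simp: inv_mult_group m_assoc subset_iff)
      then show ?case using norm[OF inv t] subgroup.m_inv_closed[OF sA] by simp
    next
      case (eng h1 h2)
      then have "h1 \<in> carrier G" "h2 \<in> carrier G" using AG by blast+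
      then have "t \<otimes> (h1 \<otimes> h2) \<otimes> inv t = (t \<otimes> h1 \<otimes> inv t) \<otimes> (t \<otimes> h2 \<otimes> inv t)"
        using tG by (simp add: m_assoc inv_solve_left)
      then show ?case using eng subgroup.m_closed[OF sA] by simp
    qed
    then show "t \<in> ?N" using tG by blast
  qed
  then have "generate G T \<subseteq> ?N"
    using generate_subgroup_incl subgroup_normalizing_elements[OF fin AG] by blast
  then have P: "p_subgroup p (?A <#> generate G T)"
    by (intro p_subgroup_mult[OF pS pT]) blast
  have "S \<union> T \<subseteq> ?A <#> generate G T"
  proof
    fix x assume "x \<in> S \<union> T"
    then show "x \<in> ?A <#> generate G T"
    proof
      assume x: "x \<in> S"
      then have "x = x \<otimes> \<one>" using S by auto
      then show ?thesis unfolding set_mult_def using generate.incl[OF x] generate.one by blast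
    next
      assume x: "x \<in> T"
      then have "x = \<one> \<otimes> x" using T by auto
      then show ?thesis unfolding set_mult_def using generate.incl[OF x] generate.one by blast
    qed
  qed
  then have "generate G (S \<union> T) \<subseteq> ?A <#> generate G T"
    using generate_subgroup_incl P by (simp add: p_subgroup_def)
  then show ?thesis using P p_subgroup_subset generate_is_subgroup S T by (meson Un_least)
qed

lemma p_subgroup_cyclic:
  assumes "g \<in> carrier G" "g [^] (p ^ k) = \<one>"
  shows "p_subgroup p (generate G {g})"
proof -
  have "x [^] (p ^ k) = \<one>" if x: "x \<in> generate G {g}" for x
  proof -
    obtain i :: int where "x = g [^] i" using x generate_pow[OF assms(1)] by auto
    then have "x [^] (p ^ k) = (g [^] (p ^ k)) [^] i"
      using assms(1) by (metis int_pow_int int_pow_pow mult.commute)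
    then show ?thesis using assms(2) by simp
  qed
  then show ?thesis using generate_is_subgroup assms(1) by (auto simp: p_subgroup_def)
qed

lemma p_subgroup_generate_insert:
  assumes fin: "finite (carrier G)" and S: "S \<subseteq> carrier G" and g: "g \<in> carrier G" "g [^] (p ^ k) = \<one>"
    and pS: "p_subgroup p (generate G S)"
    and norm: "\<And>s. s \<in> S \<Longrightarrow> g \<otimes> s \<otimes> inv g \<in> generate G S"
  shows "p_subgroup p (generate G (insert g S))"
  using p_subgroup_generate_Un[OF fin S _ pS p_subgroup_cyclic[OF g], of] norm g by auto

end

text \<open>The moved points split into orbits of more than one element, whose lengths divide
  \<open>p ^ n\<close> by the orbit-stabilizer theorem.\<close>

lemma (in group_action) prime_dvd_card_moved_points:
  assumes G: "order G = p ^ n" "finite (carrier G)" and p: "prime p"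
    and X: "X \<subseteq> E" "finite X" and inv: "\<And>g x. g \<in> carrier G \<Longrightarrow> x \<in> X \<Longrightarrow> \<phi> g x \<in> X"
  shows "p dvd card (X - {x \<in> X. \<forall>g\<in>carrier G. \<phi> g x = x})" (is "p dvd card (X - ?F)")
proof -
  let ?C = "orbit G \<phi> ` (X - ?F)"
  have sub: "orbit G \<phi> x \<subseteq> X - ?F" if x: "x \<in> X - ?F" for x
  proof
    fix y assume y: "y \<in> orbit G \<phi> x"
    then have yX: "y \<in> X" using inv x by (auto simp: orbit_def)
    have "x \<in> orbit G \<phi> y" using orbit_sym y x yX X(1) by blast
    then obtain g where g: "g \<in> carrier G" "\<phi> g y = x" by (auto simp: orbit_def)
    have "y \<notin> ?F"
    proof
      assume "y \<in> ?F"
      then have "x = y" using g by auto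
      then show False using x \<open>y \<in> ?F\<close> by blast
    qed
    then show "y \<in> X - ?F" using yX by blast
  qed
  have un: "\<Union> ?C = X - ?F"
    using sub orbit_refl X(1) by blast
  have "p dvd card (\<Union> ?C)"
  proof (rule dvd_partition)
    show "finite (\<Union> ?C)" using un X by simp
    show "\<forall>c\<in>?C. p dvd card c"
    proof
      fix c assume "c \<in> ?C"
      then obtain x where x: "x \<in> X - ?F" "c = orbit G \<phi> x" by blast
      have "card c * card (stabilizer G \<phi> x) = p ^ n"
        using orbit_stabilizer_theorem[of x] x X G by auto
      then obtain i where i: "card c = p ^ i"
        by (metis dvd_triv_left divides_primepow_nat p)
      obtain g where "g \<in> carrier G" "\<phi> g x \<noteq> x" using x by blast
      then have "{x, \<phi> g x} \<subseteq> c" using x X orbit_refl by (auto simp: orbit_def)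
      moreover have "finite c" using sub[OF x(1)] x(2) X(2) finite_subset by blast
      ultimately have "card {x, \<phi> g x} \<le> card c" by (intro card_mono)
      then have "card c \<ge> 2" using \<open>\<phi> g x \<noteq> x\<close> by (metis card_2_iff)
      then have "i \<noteq> 0" using i by (intro notI) simp
      then show "p dvd card c" using i by simp
    qed
    show "\<forall>c1\<in>?C. \<forall>c2\<in>?C. c1 \<noteq> c2 \<longrightarrow> c1 \<inter> c2 = {}"
      using partition.disjoint_union[OF orbit_partition] X(1) unfolding orbits_def by blast
  qed
  then show ?thesis using un by simp
qed

section \<open>From pairs generating p-groups to a whole p-group\<close>

context group
begin

text \<open>This replaces the growth of normalizers in \<open>p\<close>-groups: the conjugates of \<open>I\<close> are acted upon by
  the \<open>p\<close>-group generated by \<open>I\<close>, which then fixes a second conjugate besides \<open>I\<close> itself.\<close>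

lemma conjugate_normalizing_subset:
  assumes fin: "finite (carrier G)" and p: "prime p" and P: "p_subgroup p P"
    and I: "I \<subseteq> P" and self: "\<And>h. h \<in> I \<Longrightarrow> h <# I #> inv h = I"
    and g0: "g0 \<in> P" "g0 <# I #> inv g0 \<noteq> I"
  obtains g where "g \<in> P" "g <# I #> inv g \<noteq> I"
    "\<And>h. h \<in> g <# I #> inv g \<Longrightarrow> h <# I #> inv h = I"
proof -
  have sP: "subgroup P G" using P by (simp add: p_subgroup_def)
  have PG: "P \<subseteq> carrier G" using sP subgroup.subset by blast
  have IG: "I \<subseteq> carrier G" using I PG by blast
  define E where "E = {H. H \<subseteq> carrier G}"
  define \<phi> where "\<phi> = (\<lambda>g. \<lambda>H\<in>E. g <# H #> inv g)"
  interpret A: group_action G E \<phi>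
    unfolding E_def \<phi>_def by (rule action_by_conjugation_on_power_set)
  interpret AP: group_action "G\<lparr>carrier := P\<rparr>" E \<phi> by (rule A.induced_action[OF sP])
  have \<phi>: "\<phi> g J = g <# J #> inv g" if "J \<subseteq> carrier G" for g J
    using that by (simp add: \<phi>_def E_def)
  have IE: "I \<in> E" using IG by (simp add: E_def)
  define H where "H = generate G I"
  have sH: "subgroup H G" unfolding H_def by (rule generate_is_subgroup[OF IG])
  have HP: "H \<subseteq> P" unfolding H_def by (rule generate_subgroup_incl[OF I sP])
  interpret AH: group_action "G\<lparr>carrier := H\<rparr>" E \<phi> by (rule A.induced_action[OF sH])
  define X where "X = orbit (G\<lparr>carrier := P\<rparr>) \<phi> I"
  have X: "X = {\<phi> g I | g. g \<in> P}" by (simp add: X_def orbit_def)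
  have finE: "finite E" unfolding E_def using fin by (simp add: Pow_def[symmetric])
  have XE: "X \<subseteq> E" using X IE AP.element_image by fastforce
  have finX: "finite X" using XE finE finite_subset by blast
  obtain n where n: "card P = p ^ n" using p_subgroup_card[OF fin p P] by blast
  obtain m where m: "card H = p ^ m"
    using p_subgroup_card[OF fin p p_subgroup_subset[OF P sH HP]] by blast
  have "card X * card (stabilizer (G\<lparr>carrier := P\<rparr>) \<phi> I) = p ^ n"
    using AP.orbit_stabilizer_theorem[OF IE] n by (simp add: X_def order_def)
  then obtain i where i: "card X = p ^ i" by (metis dvd_triv_left divides_primepow_nat p)
  have IX: "I \<in> X" unfolding X_def by (rule AP.orbit_refl[OF IE])
  have "\<phi> g0 I \<in> X" "\<phi> g0 I \<noteq> I" using X g0 \<phi>[OF IG] by auto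
  then have "card {I, \<phi> g0 I} \<le> card X" using IX finX by (intro card_mono) auto
  then have "card X \<ge> 2" using \<open>\<phi> g0 I \<noteq> I\<close> by (metis card_2_iff)
  then have "i \<noteq> 0" using i by (intro notI) simp
  then have pX: "p dvd card X" using i by simp
  define F where "F = {J \<in> X. \<forall>h\<in>H. \<phi> h J = J}"
  have comp: "\<phi> (g \<otimes> h) J = \<phi> g (\<phi> h J)" if "g \<in> carrier G" "h \<in> carrier G" "J \<in> E" for g h J
    using that A.composition_rule by blast
  have closed: "\<phi> g J \<in> X" if gJ: "g \<in> H" "J \<in> X" for g J
  proof -
    obtain k where k: "k \<in> P" "J = \<phi> k I" using gJ(2) unfolding X by blast
    have "\<phi> g J = \<phi> (g \<otimes> k) I" using comp[of g k I] k gJ(1) HP PG IE by auto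
    moreover have "g \<otimes> k \<in> P" using k(1) gJ(1) HP subgroup.m_closed[OF sP] by blast
    ultimately show ?thesis unfolding X by blast
  qed
  have "finite H" using finite_subset[OF _ fin] HP PG by blast
  then have "p dvd card (X - F)"
    unfolding F_def using AH.prime_dvd_card_moved_points[of p m X] m p finX XE closed
    by (simp add: order_def)
  moreover have FX: "F \<subseteq> X" by (auto simp: F_def)
  then have "card X = card (X - F) + card F"
    using finX by (simp add: card_Diff_subset card_mono finite_subset)
  ultimately have "p dvd card F" using pX by (metis dvd_add_right_iff)
  \<comment> \<open>The elements of \<open>I\<close> normalize \<open>I\<close>, hence so does all
    of \<open>H\<close>. So \<open>F\<close> is nonempty, and a cardinality divisible by
    \<open>p\<close> leaves room for a second fixed conjugate.\<close>
  have "I \<in> F"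
  proof -
    let ?S = "stabilizer G \<phi> I"
    have "I \<subseteq> ?S" using self IG \<phi>[OF IG] by (auto simp: stabilizer_def)
    then have "H \<subseteq> ?S" unfolding H_def
      using generate_subgroup_incl A.stabilizer_subgroup[OF IE] by blast
    then show ?thesis using IX by (auto simp: F_def stabilizer_def)
  qed
  have finF: "finite F" using FX finX finite_subset by blast
  have "card F > 0" using \<open>I \<in> F\<close> finF card_gt_0_iff by blast
  then have "card F \<ge> 2" using \<open>p dvd card F\<close> prime_ge_2_nat[OF p] dvd_imp_le order_trans by blast
  then have "\<not> F \<subseteq> {I}" using card_mono[of "{I}" F] by auto
  then obtain J where J: "J \<in> F" "J \<noteq> I" by blast
  then obtain k where k: "k \<in> P" "J = \<phi> k I" using FX unfolding X by blast
  have kG: "k \<in> carrier G" using k PG by blast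
  have kJ: "\<phi> (inv k) J = I"
    using k kG comp[of "inv k" k I] IE by (simp add: A.id_eq_one[symmetric])
  \<comment> \<open>\<open>H\<close> normalizes the second conjugate \<open>J\<close> of
    \<open>I\<close> by \<open>k\<close>; conjugating back by \<open>inv k\<close>, the conjugate of
    \<open>I\<close> by \<open>inv k\<close> consists of elements that normalize
    \<open>I\<close>.\<close>
  show thesis
  proof (rule that[of "inv k"])
    show "inv k \<in> P" using k subgroup.m_inv_closed[OF sP] by blast
    show "inv k <# I #> inv (inv k) \<noteq> I"
    proof
      assume "inv k <# I #> inv (inv k) = I"
      then have "\<phi> (inv k) I = \<phi> (inv k) J" using \<phi>[OF IG] kJ by simp
      then have "I = J" using A.inj_prop[of "inv k"] kG IE J(1) FX XE by (metis inj_onD inv_closed subsetD)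
      then show False using J by blast
    qed
    fix h assume "h \<in> inv k <# I #> inv (inv k)"
    then obtain i where i: "i \<in> I" "h = inv k \<otimes> i \<otimes> k"
      unfolding conj_l_r_coset using kG by auto
    have iG: "i \<in> carrier G" using i IG by blast
    have "\<phi> i J = J" using J i generate.incl[of i I G] by (auto simp: F_def H_def)
    then have "\<phi> h I = I"
      using i kG iG IE comp[of "inv k \<otimes> i" k I] comp[of "inv k" i J] k kJ J FX XE by auto
    then show "h <# I #> inv h = I" using \<phi>[OF IG] by simp
  qed
qed

lemma inv_cancel_left:
  assumes "x \<in> carrier G" "y \<in> carrier G"
  shows "inv x \<otimes> (x \<otimes> y) = y" "x \<otimes> (inv x \<otimes> y) = y"
  using assms by (simp_all add: m_assoc[symmetric])

text \<open>Among pairs of distinct maximal subsets of \<open>X\<close> generating p-groups, one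
  with the largest intersection \<open>I\<close> is taken. Each member contains an element outside
  \<open>I\<close> that normalizes \<open>I\<close>. These two elements generate a p-group by
  \<open>pair\<close>, and together with \<open>I\<close> still one; a maximal set containing all of
  this meets both members in more than \<open>I\<close>, so it equals both.\<close>

lemma baer_suzuki:
  assumes fin: "finite (carrier G)" and p: "prime p" and X: "X \<subseteq> carrier G"
    and conj: "\<And>g x. g \<in> carrier G \<Longrightarrow> x \<in> X \<Longrightarrow> g \<otimes> x \<otimes> inv g \<in> X"
    and pair: "\<And>x y. x \<in> X \<Longrightarrow> y \<in> X \<Longrightarrow> p_subgroup p (generate G {x, y})"
  shows "p_subgroup p (generate G X)"
proof (rule ccontr)
  assume not_p: "\<not> p_subgroup p (generate G X)"
  define good where "good Y \<longleftrightarrow> Y \<subseteq> X \<and> p_subgroup p (generate G Y)" for Y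
  define maximal where "maximal M \<longleftrightarrow> good M \<and> (\<forall>Y. good Y \<longrightarrow> M \<subseteq> Y \<longrightarrow> Y = M)" for M
  have finX: "finite X" using X fin finite_subset by blast
  have good_sub: "good Y'" if "good Y" "Y' \<subseteq> X" "Y' \<subseteq> generate G Y" for Y Y'
  proof -
    have "generate G Y' \<subseteq> generate G Y"
      using that generate_subgroup_incl by (simp add: good_def p_subgroup_def)
    then show ?thesis
      using that X generate_is_subgroup[of Y'] p_subgroup_subset unfolding good_def by (meson order_trans)
  qed
  have extend: "\<exists>M. maximal M \<and> Y \<subseteq> M" if "good Y" for Y
  proof -
    have "{Y. good Y} \<subseteq> Pow X" by (auto simp: good_def)
    then have "finite {Y. good Y}" using finX finite_subset by blast
    from finite_has_maximal2[OF this, of Y] that obtain M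
      where "good M" "Y \<subseteq> M" "\<And>B. good B \<Longrightarrow> M \<subseteq> B \<Longrightarrow> M = B" by auto
    then show ?thesis unfolding maximal_def by auto
  qed
  \<comment> \<open>By this, a conjugate of an element of \<open>X\<close> that lies in
    \<open>generate G M\<close> already belongs to \<open>M\<close>.\<close>
  have closed: "M = X \<inter> generate G M" if "maximal M" for M
  proof -
    have "good M" using that by (simp add: maximal_def)
    then have "good (X \<inter> generate G M)" by (rule good_sub) auto
    moreover have "M \<subseteq> X \<inter> generate G M" using that generate.incl[of _ M G] by (auto simp: maximal_def good_def)
    ultimately show ?thesis using that unfolding maximal_def by metis
  qed
  have distinct: "\<exists>M1 M2. maximal M1 \<and> maximal M2 \<and> M1 \<noteq> M2"
  proof -
    have "good {}"
      using p_subgroup_cyclic[of \<one> p 0] generate_empty generate_one by (simp add: good_def)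
    then obtain M1 where M1: "maximal M1" using extend by blast
    then have "M1 \<noteq> X" "M1 \<subseteq> X" using not_p by (auto simp: maximal_def good_def)
    then obtain x where x: "x \<in> X" "x \<notin> M1" by blast
    have "good {x}" using pair[of x x] x by (simp add: good_def)
    then obtain M2 where "maximal M2" "{x} \<subseteq> M2" using extend by blast
    then show ?thesis using M1 x by blast
  qed
  define Q where "Q = (\<lambda>(M1, M2). maximal M1 \<and> maximal M2 \<and> M1 \<noteq> M2)"
  have bound: "card (fst MM \<inter> snd MM) < Suc (card X)" if "Q MM" for MM
    using that finX by (auto simp: Q_def maximal_def good_def less_Suc_eq_le intro!: card_mono)
  obtain MM where "Q MM" and MM: "\<And>MM'. Q MM' \<Longrightarrow> card (fst MM' \<inter> snd MM') \<le> card (fst MM \<inter> snd MM)"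
    using ex_has_greatest_nat[of Q _ "\<lambda>MM. card (fst MM \<inter> snd MM)" "Suc (card X)"] distinct bound
    by (metis (mono_tags, lifting) Q_def case_prod_conv)
  then obtain M1 M2 where M: "maximal M1" "maximal M2" "M1 \<noteq> M2" and MM_eq: "MM = (M1, M2)"
    by (auto simp: Q_def)
  have largest: "card (M \<inter> M') \<le> card (M1 \<inter> M2)" if "maximal M" "maximal M'" "M \<noteq> M'" for M M'
    using MM[of "(M, M')"] that MM_eq by (simp add: Q_def)
  define I where "I = M1 \<inter> M2"
  have IX: "I \<subseteq> X" using M by (auto simp: I_def maximal_def good_def)
  then have IG: "I \<subseteq> carrier G" and finI: "finite I" using X finX finite_subset by blast+
  have card_conj: "card (g <# I #> inv g) = card I" if "g \<in> carrier G" for g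
    unfolding conj_l_r_coset using that IG
    by (intro card_image inj_onI) (metis conjugation_is_inj subsetD)
  \<comment> \<open>Conjugation by an element of \<open>I\<close> stays inside both maximal sets,
    hence inside \<open>I\<close>; equality follows by counting.\<close>
  have self: "h <# I #> inv h = I" if h: "h \<in> I" for h
  proof -
    have hG: "h \<in> carrier G" using h IG by blast
    have "h <# I #> inv h \<subseteq> M" if "maximal M" "I \<subseteq> M" for M
    proof
      have sM: "subgroup (generate G M) G" using that by (simp add: maximal_def good_def p_subgroup_def)
      fix y assume "y \<in> h <# I #> inv h"
      then obtain i where i: "i \<in> I" "y = h \<otimes> i \<otimes> inv h" unfolding conj_l_r_coset by blast
      have "h \<in> generate G M" "i \<in> generate G M" using h i that generate.incl[of _ M G] by blast+
      then have "y \<in> generate G M"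
        using i sM subgroup.m_closed subgroup.m_inv_closed by metis
      moreover have "y \<in> X" using conj[OF hG] i IX by blast
      ultimately show "y \<in> M" using closed[OF that(1)] by blast
    qed
    then have "h <# I #> inv h \<subseteq> I" using M unfolding I_def by blast
    then show ?thesis using card_conj[OF hG] finI card_subset_eq by blast
  qed
  \<comment> \<open>If \<open>generate G M\<close> normalizes \<open>I\<close>, any element of
    \<open>M - I\<close> will do. Otherwise a different conjugate of \<open>I\<close> consists of
    elements normalizing \<open>I\<close>, and one of them is outside \<open>I\<close>.\<close>
  have norm: "\<exists>y\<in>M - I. y <# I #> inv y = I" if M: "maximal M" "I \<subset> M" for M
  proof (cases "\<forall>g\<in>generate G M. g <# I #> inv g = I")
    case True
    then show ?thesis using M(2) generate.incl[of _ M G] by blast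
  next
    case False
    then obtain g0 where g0: "g0 \<in> generate G M" "g0 <# I #> inv g0 \<noteq> I" by blast
    have pM: "p_subgroup p (generate G M)" using M by (simp add: maximal_def good_def)
    then have sM: "subgroup (generate G M) G" by (simp add: p_subgroup_def)
    have IM: "I \<subseteq> generate G M" using M generate.incl[of _ M G] by blast
    obtain g where g: "g \<in> generate G M" "g <# I #> inv g \<noteq> I"
      and gI: "\<And>h. h \<in> g <# I #> inv g \<Longrightarrow> h <# I #> inv h = I"
      using conjugate_normalizing_subset[OF fin p pM IM self g0] by blast
    have gG: "g \<in> carrier G" using g sM subgroup.subset by blast
    have "\<not> g <# I #> inv g \<subseteq> I" using g card_conj[OF gG] finI card_subset_eq by blast
    then obtain y where y: "y \<in> g <# I #> inv g" "y \<notin> I" by blast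
    then obtain i where i: "i \<in> I" "y = g \<otimes> i \<otimes> inv g" unfolding conj_l_r_coset by blast
    have "y \<in> generate G M" using i g IM sM subgroup.m_closed subgroup.m_inv_closed by (metis subsetD)
    moreover have "y \<in> X" using conj[OF gG] i IX by blast
    ultimately show ?thesis using closed[OF M(1)] y gI by blast
  qed
  have ne: "\<not> M1 \<subseteq> M2" "\<not> M2 \<subseteq> M1" using M unfolding maximal_def by blast+
  then obtain y1 y2 where y1: "y1 \<in> M1" "y1 \<notin> I" "y1 <# I #> inv y1 = I"
    and y2: "y2 \<in> M2" "y2 \<notin> I" "y2 <# I #> inv y2 = I"
    using norm[OF M(1)] norm[OF M(2)] unfolding I_def by blast
  have yX: "y1 \<in> X" "y2 \<in> X" using y1 y2 M by (auto simp: maximal_def good_def)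
  have "good I" using good_sub[of M1 I] M(1) IX generate.incl[of _ M1 G] by (auto simp: I_def maximal_def)
  have "p_subgroup p (generate G (I \<union> {y1, y2}))"
  proof (rule p_subgroup_generate_Un[OF fin IG])
    show "{y1, y2} \<subseteq> carrier G" using yX X by blast
    show "p_subgroup p (generate G I)" using \<open>good I\<close> by (simp add: good_def)
    show "p_subgroup p (generate G {y1, y2})" by (rule pair[OF yX])
    fix s t assume "s \<in> I" "t \<in> {y1, y2}"
    then have "t \<otimes> s \<otimes> inv t \<in> t <# I #> inv t" "t <# I #> inv t = I"
      using y1 y2 unfolding conj_l_r_coset by blast+
    then show "t \<otimes> s \<otimes> inv t \<in> generate G I" by (simp add: generate.incl)
  qed
  then have "good (I \<union> {y1, y2})" using IX yX by (simp add: good_def)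
  then obtain M3 where M3: "maximal M3" "I \<union> {y1, y2} \<subseteq> M3" using extend by blast
  have finM3: "finite M3" using M3 finX finite_subset unfolding maximal_def good_def by blast
  have bigger: "card I < card (M3 \<inter> M)" if "insert y I \<subseteq> M3 \<inter> M" "y \<notin> I" for y M
  proof -
    have "card (insert y I) \<le> card (M3 \<inter> M)" using that finM3 by (intro card_mono) auto
    then show ?thesis using that finI by simp
  qed
  have "M3 = M1" using largest[OF M3(1) M(1)] bigger[of y1 M1] y1 M3 unfolding I_def by auto
  moreover have "M3 = M2" using largest[OF M3(1) M(2)] bigger[of y2 M2] y2 M3 unfolding I_def by auto
  ultimately show False using M(3) by simp
qed

text \<open>The centrality of \<open>z\<close> and \<open>w\<close> makes the commutator of
  \<open>r\<close> with its conjugate \<open>t\<close> central in the subgroup they generate: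
  \<open>r \<otimes> t\<close> and \<open>t \<otimes> r\<close> are \<open>z\<close> and
  \<open>w\<close> times the same element \<open>s\<close>. Collecting powers shows that
  \<open>z\<close> and \<open>w\<close> have trivial cubes. The group is then built up by adjoining
  \<open>z\<close>, \<open>w\<close>, \<open>r\<close>, \<open>t\<close>, \<open>u\<close>, each
  normalizing what is already there.\<close>

lemma p_subgroup_3_generate_pair:
  assumes fin: "finite (carrier G)" and r: "r \<in> carrier G" and u: "u \<in> carrier G"
    and r3: "r \<otimes> r \<otimes> r = \<one>" and u3: "u \<otimes> u \<otimes> u = \<one>"
    and z: "z = (r \<otimes> u) [^] (3::nat)" and w: "w = (r \<otimes> inv u) [^] (3::nat)"
    and zr: "z \<otimes> r = r \<otimes> z" and zu: "z \<otimes> u = u \<otimes> z"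
    and wr: "w \<otimes> r = r \<otimes> w" and wu: "w \<otimes> u = u \<otimes> w"
  shows "p_subgroup 3 (generate G {r, u})"
proof -
  have [simp]: "z \<in> carrier G" "w \<in> carrier G" using z w r u by auto
  note [simp] = r u inv_cancel_left m_assoc inv_mult_group
  \<comment> \<open>As the cube of \<open>u\<close> is trivial, \<open>r\<close>, \<open>t\<close>
    and \<open>inv s\<close> are all the conjugates of \<open>r\<close> under powers of
    \<open>u\<close>.\<close>
  define t where "t = u \<otimes> r \<otimes> inv u"
  define s where "s = inv u \<otimes> inv r \<otimes> u"
  have [simp]: "t \<in> carrier G" "s \<in> carrier G" by (simp_all add: t_def s_def)
  have uu: "u \<otimes> (u \<otimes> x) = inv u \<otimes> x" if "x \<in> carrier G" for x
  proof -
    have "inv u = u \<otimes> u" using u3 by (intro inv_equality) simp_all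
    then show ?thesis using that by simp
  qed
  have ww: "w = r \<otimes> (inv u \<otimes> (r \<otimes> (inv u \<otimes> (r \<otimes> inv u))))" and zz: "z = r \<otimes> (u \<otimes> (r \<otimes> (u \<otimes> (r \<otimes> u))))"
    using z w by (simp_all add: numeral_3_eq_3)
  have w_inv: "w \<otimes> inv r = inv r \<otimes> w" "w \<otimes> inv u = inv u \<otimes> w"
    using wr wu by (metis inv_closed inv_solve_left inv_solve_right m_assoc m_closed r u \<open>w \<in> carrier G\<close>)+
  have z_inv: "z \<otimes> inv r = inv r \<otimes> z" "z \<otimes> inv u = inv u \<otimes> z"
    using zr zu by (metis inv_closed inv_solve_left inv_solve_right m_assoc m_closed r u \<open>z \<in> carrier G\<close>)+
  have rt: "r \<otimes> t = z \<otimes> s"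
  proof -
    have "z \<otimes> s = r \<otimes> (u \<otimes> (r \<otimes> (u \<otimes> u)))" by (simp add: zz s_def)
    also have "\<dots> = r \<otimes> t" using uu[of \<one>] by (simp add: t_def)
    finally show ?thesis by simp
  qed
  have tr: "t \<otimes> r = w \<otimes> s"
  proof -
    have "w \<otimes> (inv r \<otimes> u) = (w \<otimes> inv r) \<otimes> u" by (simp del: w_inv)
    also have "\<dots> = inv r \<otimes> (w \<otimes> u)" unfolding w_inv by simp
    also have "\<dots> = inv u \<otimes> (r \<otimes> (inv u \<otimes> r))" by (simp add: ww)
    finally have *: "inv u \<otimes> (r \<otimes> (inv u \<otimes> r)) = w \<otimes> (inv r \<otimes> u)" by simp
    have "t \<otimes> r = u \<otimes> (u \<otimes> (inv u \<otimes> (r \<otimes> (inv u \<otimes> r))))" by (simp add: t_def)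
    also have "\<dots> = (inv u \<otimes> w) \<otimes> (inv r \<otimes> u)" unfolding * by (simp add: uu)
    also have "\<dots> = w \<otimes> s" unfolding w_inv(2)[symmetric] by (simp add: s_def)
    finally show ?thesis .
  qed
  have central: "x \<otimes> t = t \<otimes> x" if "x \<in> carrier G" "x \<otimes> r = r \<otimes> x" "x \<otimes> u = u \<otimes> x" "x \<otimes> inv u = inv u \<otimes> x" for x
  proof -
    have "x \<otimes> t = (x \<otimes> u) \<otimes> (r \<otimes> inv u)" using that(1) by (simp add: t_def)
    also have "\<dots> = u \<otimes> ((x \<otimes> r) \<otimes> inv u)" unfolding that(3) using that(1) by simp
    also have "\<dots> = u \<otimes> (r \<otimes> (x \<otimes> inv u))" unfolding that(2) using that(1) by simp
    also have "\<dots> = t \<otimes> x" unfolding that(4) using that(1) by (simp add: t_def)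
    finally show ?thesis .
  qed
  have zt: "z \<otimes> t = t \<otimes> z" and wt: "w \<otimes> t = t \<otimes> w"
    using central zr zu z_inv wr wu w_inv by auto
  have wz: "w \<otimes> z = z \<otimes> w"
  proof -
    have *: "w \<otimes> (r \<otimes> x) = r \<otimes> (w \<otimes> x)" "w \<otimes> (u \<otimes> x) = u \<otimes> (w \<otimes> x)" if "x \<in> carrier G" for x
      using wr wu that by (metis \<open>w \<in> carrier G\<close> m_assoc r u)+
    show ?thesis unfolding zz by (simp add: * wr wu)
  qed
  define k where "k = w \<otimes> inv z"
  have [simp]: "k \<in> carrier G" by (simp add: k_def)
  have inv_comm': "x \<otimes> inv z = inv z \<otimes> x" if "x \<in> carrier G" "z \<otimes> x = x \<otimes> z" for x
    using that by (metis \<open>z \<in> carrier G\<close> inv_closed inv_solve_left inv_solve_right m_assoc m_closed)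
  have kr: "r \<otimes> k = k \<otimes> r" and kt: "t \<otimes> k = k \<otimes> t"
    using wr wt inv_comm'[OF _ zr] inv_comm'[OF _ zt] unfolding k_def
    by (metis \<open>t \<in> carrier G\<close> \<open>w \<in> carrier G\<close> \<open>z \<in> carrier G\<close> inv_closed m_assoc r)+
  have w_eq: "w = k \<otimes> z" by (simp add: k_def)
  have tr': "t \<otimes> r = k \<otimes> (r \<otimes> t)" unfolding tr rt by (simp add: k_def)
  have lc: "r \<otimes> (k \<otimes> x) = k \<otimes> (r \<otimes> x)" "t \<otimes> (k \<otimes> x) = k \<otimes> (t \<otimes> x)"
    "t \<otimes> (r \<otimes> x) = k \<otimes> (r \<otimes> (t \<otimes> x))" if "x \<in> carrier G" for x
    using kr kt tr' that by (metis \<open>t \<in> carrier G\<close> \<open>k \<in> carrier G\<close> m_assoc m_closed r)+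
  have r3': "r \<otimes> (r \<otimes> r) = \<one>" "r \<otimes> (r \<otimes> (r \<otimes> x)) = x" if "x \<in> carrier G" for x
    using r3 that by (metis m_assoc m_closed l_one r)+
  have t3: "t \<otimes> (t \<otimes> t) = \<one>" using r3'(2)[of "inv u"] by (simp add: t_def)
  have s3: "s \<otimes> (s \<otimes> s) = \<one>"
  proof -
    have "inv r \<otimes> (inv r \<otimes> inv r) = inv (r \<otimes> (r \<otimes> r))" by simp
    then have "inv r \<otimes> (inv r \<otimes> inv r) = \<one>" unfolding r3'(1)[OF r] by simp
    then have "inv r \<otimes> (inv r \<otimes> (inv r \<otimes> u)) = u" by (metis inv_closed l_one m_assoc m_closed r u)
    then show ?thesis by (simp add: s_def)
  qed
  \<comment> \<open>Moving \<open>t\<close> across the three factors of the trivial cube of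
    \<open>r\<close> costs one \<open>k\<close> for each.\<close>
  have k3: "k \<otimes> (k \<otimes> k) = \<one>"
  proof -
    have "t = t \<otimes> (r \<otimes> (r \<otimes> r))" using r3 by simp
    also have "\<dots> = k \<otimes> (k \<otimes> (k \<otimes> (r \<otimes> (r \<otimes> (r \<otimes> t)))))" by (simp only: lc kr m_closed r \<open>t \<in> carrier G\<close> \<open>k \<in> carrier G\<close> tr')
    also have "\<dots> = (k \<otimes> (k \<otimes> k)) \<otimes> t" by (simp add: r3')
    finally have "(k \<otimes> (k \<otimes> k)) \<otimes> t = \<one> \<otimes> t" by (simp del: m_assoc)
    then show ?thesis using right_cancel[of t "k \<otimes> (k \<otimes> k)" \<one>] by (simp del: m_assoc)
  qed
  have zs: "z \<otimes> s = s \<otimes> z"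
  proof -
    have "z \<otimes> (s \<otimes> z) = (r \<otimes> t) \<otimes> z" unfolding rt by simp
    also have "\<dots> = r \<otimes> (z \<otimes> t)" unfolding zt by simp
    also have "\<dots> = (z \<otimes> r) \<otimes> t" unfolding zr by simp
    also have "\<dots> = z \<otimes> (z \<otimes> s)" unfolding rt[symmetric] by simp
    finally show ?thesis by (simp del: m_assoc)
  qed
  \<comment> \<open>Both sides of \<open>rt\<close> are cubed: \<open>z\<close> commutes with
    \<open>s\<close>, and collecting the cube of \<open>r \<otimes> t\<close> costs exactly three
    factors \<open>k\<close>.\<close>
  have z3: "z \<otimes> (z \<otimes> z) = \<one>"
  proof -
    have lcs: "s \<otimes> (z \<otimes> x) = z \<otimes> (s \<otimes> x)" if "x \<in> carrier G" for x
      using zs that by (metis \<open>s \<in> carrier G\<close> \<open>z \<in> carrier G\<close> m_assoc)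
    have "z \<otimes> (z \<otimes> z) = z \<otimes> (z \<otimes> (z \<otimes> (s \<otimes> (s \<otimes> s))))" using s3 by simp
    also have "\<dots> = (z \<otimes> s) \<otimes> ((z \<otimes> s) \<otimes> (z \<otimes> s))" by (simp add: lcs)
    also have "\<dots> = (r \<otimes> t) \<otimes> ((r \<otimes> t) \<otimes> (r \<otimes> t))" by (simp only: rt)
    also have "\<dots> = k \<otimes> (k \<otimes> (k \<otimes> (r \<otimes> (r \<otimes> (r \<otimes> (t \<otimes> (t \<otimes> t)))))))" by (simp add: lc)
    also have "\<dots> = \<one>" using k3 r3 t3 by simp
    finally show ?thesis .
  qed
  have w3: "w \<otimes> (w \<otimes> w) = \<one>"
  proof -
    have "z \<otimes> k = (z \<otimes> w) \<otimes> inv z" by (simp add: k_def)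
    also have "\<dots> = k \<otimes> z" unfolding wz[symmetric] by (simp add: k_def)
    finally have "z \<otimes> k = k \<otimes> z" .
    then have zk: "z \<otimes> (k \<otimes> x) = k \<otimes> (z \<otimes> x)" if "x \<in> carrier G" for x
      using that by (simp add: m_assoc[symmetric] del: m_assoc)
    have "w \<otimes> (w \<otimes> w) = k \<otimes> (k \<otimes> (k \<otimes> (z \<otimes> (z \<otimes> z))))" unfolding w_eq by (simp add: zk)
    then show ?thesis using z3 k3 by simp
  qed
  have pow3: "x [^] (3 ^ 1 :: nat) = \<one>" if "x \<in> carrier G" "x \<otimes> (x \<otimes> x) = \<one>" for x
    using that by (simp add: numeral_3_eq_3)
  note step = p_subgroup_generate_insert[OF fin _ _ pow3]
  have self: "g \<otimes> x \<otimes> inv g = x" if "g \<in> carrier G" "x \<in> carrier G" "g \<otimes> x = x \<otimes> g" for g x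
    using that by simp
  have "p_subgroup 3 (generate G {z})" by (rule p_subgroup_cyclic[OF _ pow3]) (simp_all add: z3)
  then have "p_subgroup 3 (generate G {w, z})"
    by (rule step[rotated 4]) (use w3 self[of w z] wz in \<open>auto intro: generate.incl\<close>)
  then have "p_subgroup 3 (generate G {r, w, z})"
    by (rule step[rotated 4]) (use r3 self[of r w] self[of r z] wr zr in \<open>auto intro: generate.incl\<close>)
  then have "p_subgroup 3 (generate G {t, r, w, z})"
  proof (rule step[rotated 4])
    have gen: "subgroup (generate G {r, w, z}) G" by (rule generate_is_subgroup) auto
    have "t \<otimes> r \<otimes> inv t = w \<otimes> inv z \<otimes> r" unfolding tr' by (simp add: k_def)
    moreover have "w \<otimes> inv z \<otimes> r \<in> generate G {r, w, z}"
      by (intro subgroup.m_closed[OF gen] generate.incl generate.inv) auto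
    ultimately show "t \<otimes> x \<otimes> inv t \<in> generate G {r, w, z}" if "x \<in> {r, w, z}" for x
      using that self[of t w] self[of t z] zt wt by (auto intro: generate.incl)
  qed (auto simp: t3)
  then have P: "p_subgroup 3 (generate G {u, t, r, w, z})"
  proof (rule step[rotated 4])
    have gen: "subgroup (generate G {t, r, w, z}) G" by (rule generate_is_subgroup) auto
    \<comment> \<open>Conjugating \<open>r\<close> twice by \<open>u\<close> is conjugating once by
      \<open>inv u\<close>, which gives \<open>inv s\<close>; by \<open>rt\<close> this is a word in
      \<open>z\<close>, \<open>r\<close> and \<open>t\<close>.\<close>
    have "u \<otimes> t \<otimes> inv u = inv s" using uu[of "r \<otimes> (inv u \<otimes> inv u)"] uu[of "inv u", symmetric] by (simp add: t_def s_def)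
    also have "inv s = inv (inv z \<otimes> (r \<otimes> t))" unfolding rt by simp
    finally have ut: "u \<otimes> t \<otimes> inv u = inv (inv z \<otimes> (r \<otimes> t))" .
    have "inv (inv z \<otimes> (r \<otimes> t)) \<in> generate G {t, r, w, z}"
      by (intro subgroup.m_closed[OF gen] subgroup.m_inv_closed[OF gen] generate.incl generate.inv) auto
    moreover have "u \<otimes> r \<otimes> inv u \<in> generate G {t, r, w, z}" unfolding t_def[symmetric] by (rule generate.incl) simp
    ultimately show "u \<otimes> x \<otimes> inv u \<in> generate G {t, r, w, z}" if "x \<in> {t, r, w, z}" for x
      using that self[of u w] self[of u z] zu wu ut by (auto intro: generate.incl simp del: m_assoc inv_mult_group)
  qed (use u3 in auto)
  have "generate G {r, u} \<subseteq> generate G {u, t, r, w, z}" by (rule mono_generate) blast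
  then show ?thesis using p_subgroup_subset[OF P] generate_is_subgroup[of "{r, u}"] by simp
qed

end

section \<open>Modules over the Eisenstein integers\<close>

lemma three_dvd_card_if_fixed_point_free:
  assumes "finite S" "\<And>x. x \<in> S \<Longrightarrow> f x \<in> S" "\<And>x. x \<in> S \<Longrightarrow> f (f (f x)) = x" "\<And>x. x \<in> S \<Longrightarrow> f x \<noteq> x"
  shows "3 dvd card S"
  using assms
proof (induction S rule: finite_psubset_induct)
  case (psubset S)
  show ?case
  proof (cases "S = {}")
    case False
    then obtain x where x: "x \<in> S" by blast
    let ?T = "{x, f x, f (f x)}"
    have TS: "?T \<subseteq> S" using x psubset.prems(1) by blast
    have neq: "f x \<noteq> x" "f (f x) \<noteq> f x" "f (f x) \<noteq> x"
      using psubset.prems x by metis+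
    then have T: "card ?T = 3" by simp
    have "3 dvd card (S - ?T)"
    proof (rule psubset.IH)
      show "S - ?T \<subset> S" using x by blast
      fix y assume y: "y \<in> S - ?T"
      then show "f (f (f y)) = y" "f y \<noteq> y" using psubset.prems by blast+
      have "f y \<notin> ?T"
      proof
        assume "f y \<in> ?T"
        then have "f (f (f y)) \<in> ?T" using psubset.prems(2)[OF x] by auto
        then show False using y psubset.prems(2) by simp
      qed
      then show "f y \<in> S - ?T" using y psubset.prems(1) by blast
    qed
    moreover have "card S = card (S - ?T) + card ?T"
      using TS psubset.hyps by (simp add: card_Diff_subset card_mono)
    ultimately show ?thesis using T by simp
  qed simp
qed

text \<open>Modulo 3 the number \<open>q\<close> is -1, so its odd powers leave remainder 2 and not
  1.\<close>

lemma even_exponent_if_dvd: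
  fixes q k :: nat
  assumes "[q = 2] (mod 3)" "3 dvd q ^ k - 1" "q > 0"
  shows "even k"
proof (rule ccontr)
  assume "odd k"
  then obtain j where k: "k = 2 * j + 1" by (auto elim: oddE)
  have "[q ^ k = 2 ^ k] (mod 3)" using assms(1) by (rule cong_pow)
  also have "(2::nat) ^ k = 4 ^ j * 2" by (simp add: k power_mult)
  also have "[4 ^ j * 2 = 1 ^ j * 2] (mod (3::nat))"
    by (intro cong_mult cong_pow cong_refl) (simp add: cong_def)
  finally have "q ^ k mod 3 = 2" by (simp add: cong_def)
  moreover have "(q ^ k - 1) mod 3 = 0" using assms(2) by simp
  moreover have "q ^ k > 0" using assms(3) by simp
  ultimately show False by presburger
qed

text \<open>The relation satisfied by \<open>\<phi>\<close> makes \<open>G\<close> a module over the Eisenstein integers, in which \<open>q\<close> is inert.\<close>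

lemma (in comm_group) even_multiplicity_order:
  assumes fin: "finite (carrier G)" and \<phi>: "\<phi> \<in> hom G G"
    and rel: "\<And>z. z \<in> carrier G \<Longrightarrow> \<phi> (\<phi> z) \<otimes> z = \<phi> z"
    and q: "prime q" "[q = 2] (mod 3)"
  shows "even (multiplicity q (order G))"
proof -
  interpret \<phi>: group_hom G G \<phi> by (unfold_locales) (rule \<phi>)
  define k where "k = multiplicity q (order G)"
  \<comment> \<open>The Sylow \<open>q\<close>-subgroup: it contains every subgroup of order
    \<open>q ^ k\<close>, and its own order is a power of \<open>q\<close> dividing the group order.
    In this form its invariance under \<phi> is evident.\<close>
  define Q where "Q = {z \<in> carrier G. z [^] (q ^ k) = \<one>}"
  have ord: "order G \<noteq> 0" using fin order_gt_0_iff_finite by simp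
  have sQ: "subgroup Q G"
    by (rule subgroupI) (auto simp: Q_def nat_pow_distrib nat_pow_inv intro: exI[of _ \<one>])
  have pQ: "p_subgroup q Q" using sQ by (auto simp: p_subgroup_def Q_def)
  have finQ: "finite Q" using fin by (simp add: Q_def)
  obtain j where j: "card Q = q ^ j" using p_subgroup_card[OF fin q(1) pQ] by blast
  have "q ^ j dvd order G" using lagrange[OF sQ] j by (metis dvd_triv_right)
  then have "j \<le> k" unfolding k_def using ord q(1) by (intro multiplicity_geI) auto
  moreover have "k \<le> j"
  proof -
    obtain m where "order G = q ^ k * m" using multiplicity_dvd[of q "order G"] unfolding k_def by (auto elim: dvdE)
    then obtain H where H: "subgroup H G" "card H = q ^ k"
      using sylow_thm[OF q(1) is_group _ fin] by blast
    have "H \<subseteq> Q"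
    proof
      fix x assume x: "x \<in> H"
      interpret GH: group "G\<lparr>carrier := H\<rparr>" by (rule subgroup_imp_group[OF H(1)])
      have "x [^] (q ^ k) = \<one>"
        using GH.pow_order_eq_1[of x] x H(2) by (simp add: order_def nat_pow_consistent[symmetric])
      then show "x \<in> Q" using x subgroup.mem_carrier[OF H(1)] by (simp add: Q_def)
    qed
    then have "q ^ k \<le> q ^ j" using card_mono[OF finQ] H(2) j by metis
    then show ?thesis using prime_gt_1_nat[OF q(1)] by simp
  qed
  ultimately have cQ: "card Q = q ^ k" using j by simp
  have two: "\<phi> (\<phi> z) = \<phi> z \<otimes> inv z" if "z \<in> carrier G" for z
    using rel[OF that] that by (simp add: inv_solve_right)
  \<comment> \<open>In additive notation \<phi>^2 = \<phi> - 1 gives \<phi>^3 = -1, so the cube of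
    \<phi>^2 is the identity.\<close>
  have three: "\<phi> (\<phi> (\<phi> z)) = inv z" if "z \<in> carrier G" for z
    using that two[of z] two[of "\<phi> z"] by (simp add: m_assoc m_comm[of "inv z"] ) (simp add: m_assoc[symmetric])
  have "3 dvd card (Q - {\<one>})"
  proof (rule three_dvd_card_if_fixed_point_free[where f = "\<lambda>z. \<phi> (\<phi> z)"])
    show "finite (Q - {\<one>})" using finQ by simp
    fix z assume z: "z \<in> Q - {\<one>}"
    then have zG: "z \<in> carrier G" and zq: "z [^] (q ^ k) = \<one>" "z \<noteq> \<one>" by (auto simp: Q_def)
    show six: "\<phi> (\<phi> (\<phi> (\<phi> (\<phi> (\<phi> z))))) = z" using three zG by simp
    have "\<phi> (\<phi> z) \<noteq> \<one>"
    proof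
      assume "\<phi> (\<phi> z) = \<one>"
      then show False using six zq(2) by simp
    qed
    moreover have "\<phi> (\<phi> z) \<in> Q" using zG zq by (simp add: Q_def flip: \<phi>.hom_nat_pow)
    ultimately show "\<phi> (\<phi> z) \<in> Q - {\<one>}" by simp
    show "\<phi> (\<phi> z) \<noteq> z"
    proof
      \<comment> \<open>A fixed point satisfies \<open>\<phi> z = z \<otimes> z\<close>; applying
        \<phi> again gives z^4 = z. Its order then divides both 3 and a power of
        \<open>q\<close>.\<close>
      assume fixed: "\<phi> (\<phi> z) = z"
      then have "\<phi> z = z \<otimes> z" using rel[OF zG] by simp
      then have "(z \<otimes> z) \<otimes> (z \<otimes> z) = z" using fixed zG by simp
      then have "z \<otimes> (z \<otimes> (z \<otimes> z)) = z \<otimes> \<one>" using zG by (simp add: m_assoc)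
      then have "z [^] (3::nat) = \<one>" using zG by (simp add: numeral_3_eq_3 m_assoc)
      then have "ord z dvd 3" "ord z dvd q ^ k" using zq zG pow_eq_id by blast+
      moreover have "coprime 3 q"
      proof -
        have "\<not> 3 dvd q" using q(2) by (auto simp: cong_def)
        then show ?thesis using prime_imp_coprime[of 3 q] by simp
      qed
      then have "coprime 3 (q ^ k)" by simp
      ultimately have "ord z = 1" using coprime_common_divisor_nat by blast
      then show False using zq zG ord_eq_1 by blast
    qed
  qed
  moreover have "card (Q - {\<one>}) = q ^ k - 1" using cQ finQ subgroup.one_closed[OF sQ] by simp
  ultimately show ?thesis
    using even_exponent_if_dvd[OF q(2)] prime_gt_0_nat[OF q(1)] unfolding k_def by metis
qed

section \<open>Quandles and Hall triple systems\<close>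

text \<open>The maps are extensional and composed by \<open>compose\<close>, as in
  \<open>BijGroup V\<close>: automorphisms agreeing on \<open>V\<close> are equal, and the group
  laws can be inherited from there.\<close>

definition magma_aut :: "'a set \<Rightarrow> ('a \<Rightarrow> 'a \<Rightarrow> 'a) \<Rightarrow> ('a \<Rightarrow> 'a) monoid" where
  "magma_aut V m = \<lparr>carrier = {f \<in> extensional V. bij_betw f V V \<and> (\<forall>x\<in>V. \<forall>y\<in>V. f (m x y) = m (f x) (f y))},
     mult = compose V, one = \<lambda>x\<in>V. x\<rparr>"

locale finite_quandle =
  fixes V :: "'a set" and m :: "'a \<Rightarrow> 'a \<Rightarrow> 'a" (infixl "\<cdot>" 70)
  assumes finite_carrier: "finite V"
    and m_closed: "x \<in> V \<Longrightarrow> y \<in> V \<Longrightarrow> x \<cdot> y \<in> V"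
    and m_idem: "x \<in> V \<Longrightarrow> x \<cdot> x = x"
    and m_distrib: "x \<in> V \<Longrightarrow> y \<in> V \<Longrightarrow> z \<in> V \<Longrightarrow> x \<cdot> (y \<cdot> z) = (x \<cdot> y) \<cdot> (x \<cdot> z)"
    and m_bij: "x \<in> V \<Longrightarrow> bij_betw (\<lambda>y. x \<cdot> y) V V"
begin

abbreviation Aut where "Aut \<equiv> magma_aut V (\<cdot>)"

definition L :: "'a \<Rightarrow> 'a \<Rightarrow> 'a" where "L x = (\<lambda>y\<in>V. x \<cdot> y)"

lemma aut_apply: "f \<in> carrier Aut \<Longrightarrow> g \<in> carrier Aut \<Longrightarrow> x \<in> V \<Longrightarrow> (f \<otimes>\<^bsub>Aut\<^esub> g) x = f (g x)"
  by (simp add: magma_aut_def compose_def)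

lemma one_apply: "x \<in> V \<Longrightarrow> \<one>\<^bsub>Aut\<^esub> x = x"
  by (simp add: magma_aut_def)

lemma aut_closed: "f \<in> carrier Aut \<Longrightarrow> x \<in> V \<Longrightarrow> f x \<in> V"
  by (auto simp: magma_aut_def bij_betw_def)

lemma aut_hom: "f \<in> carrier Aut \<Longrightarrow> x \<in> V \<Longrightarrow> y \<in> V \<Longrightarrow> f (x \<cdot> y) = f x \<cdot> f y"
  by (simp add: magma_aut_def)

lemma aut_eqI:
  assumes "f \<in> carrier Aut" "g \<in> carrier Aut" "\<And>x. x \<in> V \<Longrightarrow> f x = g x"
  shows "f = g"
  using assms by (intro extensionalityI[of _ V]) (auto simp: magma_aut_def)

lemma aut_action: "group_action Aut V (\<lambda>f. f)" and aut_group: "group Aut"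
proof -
  have sub: "subgroup (carrier Aut) (BijGroup V)"
  proof (rule group.subgroupI[OF group_BijGroup])
    show "carrier Aut \<subseteq> carrier (BijGroup V)" by (auto simp: magma_aut_def BijGroup_def Bij_def)
    have "(\<lambda>x\<in>V. x) \<in> carrier Aut" using m_closed by (auto simp: magma_aut_def bij_betw_def inj_on_def)
    then show "carrier Aut \<noteq> {}" by blast
    fix f assume f: "f \<in> carrier Aut"
    then have bij: "f \<in> Bij V" by (auto simp: magma_aut_def Bij_def)
    then have inv: "inv\<^bsub>BijGroup V\<^esub> f = (\<lambda>x\<in>V. inv_into V f x)" by (rule inv_BijGroup)
    have fV: "f ` V = V" "inj_on f V" using f by (auto simp: magma_aut_def bij_betw_def)
    have "inv_into V f (x \<cdot> y) = inv_into V f x \<cdot> inv_into V f y" if xy: "x \<in> V" "y \<in> V" for x y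
    proof -
      obtain a b where ab: "a \<in> V" "b \<in> V" "x = f a" "y = f b" using xy fV(1) by (metis imageE)
      then have "x \<cdot> y = f (a \<cdot> b)" using aut_hom f by simp
      then show ?thesis using ab fV m_closed by (simp add: inv_into_f_f)
    qed
    moreover have "(\<lambda>x\<in>V. inv_into V f x) \<in> Bij V" by (rule restrict_inv_into_Bij[OF bij])
    ultimately show "inv\<^bsub>BijGroup V\<^esub> f \<in> carrier Aut"
      unfolding inv by (auto simp: magma_aut_def Bij_def m_closed)
    fix g assume g: "g \<in> carrier Aut"
    have fg: "compose V f g \<in> Bij V"
      using f g by (intro compose_Bij) (auto simp: magma_aut_def Bij_def)
    have "f \<otimes>\<^bsub>BijGroup V\<^esub> g = compose V f g"
      using f g by (simp add: magma_aut_def BijGroup_def Bij_def)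
    moreover have "compose V f g \<in> carrier Aut"
      using fg f g aut_closed[OF f] aut_closed[OF g] aut_hom[OF f] aut_hom[OF g] m_closed
      by (auto simp: magma_aut_def Bij_def compose_def)
    ultimately show "f \<otimes>\<^bsub>BijGroup V\<^esub> g \<in> carrier Aut" by simp
  qed
  \<comment> \<open>\<open>BijGroup\<close> restricts its multiplication to bijections and
    \<open>magma_aut\<close> does not, so the operations are compared on the carrier only.\<close>
  have eq: "x \<otimes>\<^bsub>Aut\<^esub> y = x \<otimes>\<^bsub>BijGroup V\<^esub> y" if "x \<in> carrier Aut" "y \<in> carrier Aut" for x y
    using that by (simp add: magma_aut_def BijGroup_def Bij_def)
  have one: "\<one>\<^bsub>Aut\<^esub> = \<one>\<^bsub>BijGroup V\<^esub>" by (simp add: magma_aut_def BijGroup_def)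
  show gr: "group Aut"
  proof (rule groupI)
    show "\<exists>y\<in>carrier Aut. y \<otimes>\<^bsub>Aut\<^esub> x = \<one>\<^bsub>Aut\<^esub>" if x: "x \<in> carrier Aut" for x
    proof (rule bexI)
      show i: "inv\<^bsub>BijGroup V\<^esub> x \<in> carrier Aut" using subgroup.m_inv_closed[OF sub x] .
      have "x \<in> carrier (BijGroup V)" using x subgroup.subset[OF sub] by blast
      then show "inv\<^bsub>BijGroup V\<^esub> x \<otimes>\<^bsub>Aut\<^esub> x = \<one>\<^bsub>Aut\<^esub>"
        using eq[OF i x] group.l_inv[OF group_BijGroup] one by (simp only:)
    qed
  next
    show "\<one>\<^bsub>Aut\<^esub> \<in> carrier Aut" unfolding one by (rule subgroup.one_closed[OF sub])
    show "\<one>\<^bsub>Aut\<^esub> \<otimes>\<^bsub>Aut\<^esub> x = x" if x: "x \<in> carrier Aut" for x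
    proof -
      have "x \<in> V \<rightarrow> V" using x aut_closed by blast
      then show ?thesis using Id_compose[of x V V] x by (simp add: magma_aut_def)
    qed
  next
    fix x y assume xy: "x \<in> carrier Aut" "y \<in> carrier Aut"
    show "x \<otimes>\<^bsub>Aut\<^esub> y \<in> carrier Aut" unfolding eq[OF xy] by (rule subgroup.m_closed[OF sub xy])
    have V: "x \<in> V \<rightarrow> V" "y \<in> V \<rightarrow> V" using xy aut_closed by blast+
    fix z assume "z \<in> carrier Aut"
    then have "z \<in> V \<rightarrow> V" using aut_closed by blast
    then show "x \<otimes>\<^bsub>Aut\<^esub> y \<otimes>\<^bsub>Aut\<^esub> z = x \<otimes>\<^bsub>Aut\<^esub> (y \<otimes>\<^bsub>Aut\<^esub> z)"
      using compose_assoc[of z V V x y] V by (simp add: magma_aut_def)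
  qed
  have "(\<lambda>f. f) \<in> hom Aut (BijGroup V)"
    using eq subgroup.mem_carrier[OF sub] by (simp add: hom_def)
  then show "group_action Aut V (\<lambda>f. f)"
    unfolding group_action_def using gr group_BijGroup by (intro group_hom.intro group_hom_axioms.intro)
qed

sublocale A: group Aut by (rule aut_group)

lemma finite_aut: "finite (carrier Aut)"
proof (rule finite_subset)
  show "carrier Aut \<subseteq> V \<rightarrow>\<^sub>E V" by (auto simp: magma_aut_def bij_betw_def PiE_def)
  show "finite (V \<rightarrow>\<^sub>E V)" by (simp add: finite_carrier finite_PiE)
qed

lemma L_apply [simp]: "y \<in> V \<Longrightarrow> L x y = x \<cdot> y"
  by (simp add: L_def)

lemma L_closed: "x \<in> V \<Longrightarrow> L x \<in> carrier Aut"
proof -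
  assume x: "x \<in> V"
  have "bij_betw (L x) V V" using m_bij[OF x] by (rule bij_betw_cong[THEN iffD1, rotated]) simp
  moreover have "L x (y \<cdot> z) = L x y \<cdot> L x z" if "y \<in> V" "z \<in> V" for y z
    using m_distrib[OF x that] x that by (simp add: m_closed)
  moreover have "L x \<in> extensional V" by (simp add: L_def)
  ultimately show ?thesis by (simp add: magma_aut_def)
qed

text \<open>In particular an automorphism fixing \<open>x\<close> commutes with \<open>L x\<close>,
  which is how fixed points yield central elements.\<close>

lemma aut_L: "f \<in> carrier Aut \<Longrightarrow> x \<in> V \<Longrightarrow> f \<otimes>\<^bsub>Aut\<^esub> L x = L (f x) \<otimes>\<^bsub>Aut\<^esub> f"
  by (rule aut_eqI) (simp_all add: L_closed aut_closed aut_apply aut_hom m_closed)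

lemma conj_L: "f \<in> carrier Aut \<Longrightarrow> x \<in> V \<Longrightarrow> f \<otimes>\<^bsub>Aut\<^esub> L x \<otimes>\<^bsub>Aut\<^esub> inv\<^bsub>Aut\<^esub> f = L (f x)"
  by (subst aut_L) (simp_all add: L_closed aut_closed A.m_assoc)

end

text \<open>The algebraic form: the blocks are the triples of distinct points x, y and their
  product, and distributivity says that the reflection in each point is an automorphism.\<close>

locale hall_triple_system =
  fixes V :: "'a set" and m :: "'a \<Rightarrow> 'a \<Rightarrow> 'a" (infixl "\<cdot>" 70)
  assumes finite_V: "finite V"
    and closed: "x \<in> V \<Longrightarrow> y \<in> V \<Longrightarrow> x \<cdot> y \<in> V"
    and idem: "x \<in> V \<Longrightarrow> x \<cdot> x = x"
    and comm: "x \<in> V \<Longrightarrow> y \<in> V \<Longrightarrow> x \<cdot> y = y \<cdot> x"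
    and invol: "x \<in> V \<Longrightarrow> y \<in> V \<Longrightarrow> x \<cdot> (x \<cdot> y) = y"
    and distrib: "x \<in> V \<Longrightarrow> y \<in> V \<Longrightarrow> z \<in> V \<Longrightarrow> x \<cdot> (y \<cdot> z) = (x \<cdot> y) \<cdot> (x \<cdot> z)"
begin

sublocale finite_quandle V m
proof
  show "bij_betw (\<lambda>y. x \<cdot> y) V V" if "x \<in> V" for x
    using that by (intro bij_betw_byWitness[of V "\<lambda>y. x \<cdot> y"]) (auto simp: closed invol)
qed (fact finite_V closed idem distrib)+

lemma cancel: "x \<in> V \<Longrightarrow> y \<in> V \<Longrightarrow> z \<in> V \<Longrightarrow> x \<cdot> y = x \<cdot> z \<longleftrightarrow> y = z"
  by (metis invol)

lemma braid: "x \<in> V \<Longrightarrow> y \<in> V \<Longrightarrow> z \<in> V \<Longrightarrow> x \<cdot> (y \<cdot> (x \<cdot> z)) = (x \<cdot> y) \<cdot> z"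
  by (subst distrib) (simp_all add: closed invol)

lemma fold: "x \<in> V \<Longrightarrow> y \<in> V \<Longrightarrow> z \<in> V \<Longrightarrow> x \<cdot> (y \<cdot> (z \<cdot> x)) = (x \<cdot> y) \<cdot> z"
  by (subst distrib) (simp_all add: comm[of z x] closed invol)

lemma swap: "x \<in> V \<Longrightarrow> y \<in> V \<Longrightarrow> z \<in> V \<Longrightarrow> x \<cdot> ((x \<cdot> y) \<cdot> z) = y \<cdot> (x \<cdot> z)"
  by (subst distrib) (simp_all add: closed invol)

text \<open>By \<open>braid\<close>, L a L b L a is the translation by the product of
  \<open>a\<close> and \<open>b\<close>. By commutativity it equals L b L a L b, so the six
  translations form the square of an involution.\<close>

lemma cube_pair: "a \<in> V \<Longrightarrow> b \<in> V \<Longrightarrow> x \<in> V \<Longrightarrow> a \<cdot> (b \<cdot> (a \<cdot> (b \<cdot> (a \<cdot> (b \<cdot> x))))) = x"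
  by (simp add: braid closed comm[of b a] invol)

section \<open>Cubes of products of four translations\<close>

definition comp4 :: "'a \<Rightarrow> 'a \<Rightarrow> 'a \<Rightarrow> 'a \<Rightarrow> 'a \<Rightarrow> 'a" where
  "comp4 a b c d x = a \<cdot> (b \<cdot> (c \<cdot> (d \<cdot> x)))"

definition cube4 :: "'a \<Rightarrow> 'a \<Rightarrow> 'a \<Rightarrow> 'a \<Rightarrow> 'a \<Rightarrow> 'a" where
  "cube4 a b c d x = comp4 a b c d (comp4 a b c d (comp4 a b c d x))"

lemma comp4_closed: "a \<in> V \<Longrightarrow> b \<in> V \<Longrightarrow> c \<in> V \<Longrightarrow> d \<in> V \<Longrightarrow> x \<in> V \<Longrightarrow> comp4 a b c d x \<in> V"
  by (simp add: comp4_def closed)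

lemma comp4_distrib:
  assumes "a \<in> V" "b \<in> V" "c \<in> V" "d \<in> V" "x \<in> V" "y \<in> V"
  shows "comp4 a b c d (x \<cdot> y) = comp4 a b c d x \<cdot> comp4 a b c d y"
  using assms by (simp add: comp4_def closed distrib[symmetric])

lemma cube4_closed: "a \<in> V \<Longrightarrow> b \<in> V \<Longrightarrow> c \<in> V \<Longrightarrow> d \<in> V \<Longrightarrow> x \<in> V \<Longrightarrow> cube4 a b c d x \<in> V"
  by (simp add: cube4_def comp4_closed)

lemma cube4_distrib:
  assumes "a \<in> V" "b \<in> V" "c \<in> V" "d \<in> V" "x \<in> V" "y \<in> V"
  shows "cube4 a b c d (x \<cdot> y) = cube4 a b c d x \<cdot> cube4 a b c d y"
  using assms by (simp add: cube4_def comp4_distrib comp4_closed)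

lemma cube4_fixes_1:
  assumes V: "a \<in> V" "b \<in> V" "c \<in> V" "d \<in> V"
  shows "cube4 a b c d a = a"
proof -
  note [simp] = V closed
  \<comment> \<open>\<open>?e\<close> is the value after the innermost translation, leaving eleven
    more. Each \<open>swap\<close> creates a repeated letter that a \<open>fold\<close> can absorb,
    and the word shrinks from the inside.\<close>
  let ?e = "a \<cdot> d"
  have "d \<cdot> (a \<cdot> (b \<cdot> (c \<cdot> ?e))) = a \<cdot> (?e \<cdot> (b \<cdot> (c \<cdot> ?e)))" by (simp add: swap)
  also have "\<dots> = a \<cdot> ((?e \<cdot> b) \<cdot> c)" by (simp add: fold)
  finally have "b \<cdot> (c \<cdot> (d \<cdot> (a \<cdot> (b \<cdot> (c \<cdot> ?e))))) = b \<cdot> (c \<cdot> (a \<cdot> ((?e \<cdot> b) \<cdot> c)))" by simp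
  also have "\<dots> = (b \<cdot> (c \<cdot> a)) \<cdot> ?e" by (simp add: fold)
  also have "\<dots> = ?e \<cdot> (b \<cdot> (c \<cdot> a))" by (simp add: comm[of _ ?e])
  finally have "d \<cdot> (a \<cdot> (b \<cdot> (c \<cdot> (d \<cdot> (a \<cdot> (b \<cdot> (c \<cdot> ?e))))))) = a \<cdot> (b \<cdot> (c \<cdot> a))"
    by (simp add: swap invol)
  also have "\<dots> = (a \<cdot> b) \<cdot> c" by (simp add: fold)
  also have "\<dots> = c \<cdot> (a \<cdot> b)" by (simp add: comm[of _ c])
  finally have "a \<cdot> (b \<cdot> (c \<cdot> (d \<cdot> (a \<cdot> (b \<cdot> (c \<cdot> (d \<cdot> (a \<cdot> (b \<cdot> (c \<cdot> ?e)))))))))) = a \<cdot> (b \<cdot> (a \<cdot> b))"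
    by (simp add: invol)
  also have "\<dots> = a" by (simp add: comm[of a b] invol idem)
  finally show ?thesis by (simp add: cube4_def comp4_def comm[of d a])
qed

lemma cube4_rotate: "cube4 a b c d (a \<cdot> x) = a \<cdot> cube4 b c d a x"
  by (simp add: cube4_def comp4_def)

text \<open>Rotation turns the assumption into a fixed point \<open>a \<cdot> x\<close> of the
  unrotated cube. As that map is multiplicative and fixes \<open>a\<close>, cancellation gives
  \<open>x\<close>. Three rotations carry \<open>cube4_fixes_1\<close> to all four letters.\<close>

lemma cube4_fixes_if_rotated_fixes:
  assumes V: "a \<in> V" "b \<in> V" "c \<in> V" "d \<in> V" "x \<in> V" and x: "cube4 b c d a x = x"
  shows "cube4 a b c d x = x"
proof -
  have "a \<cdot> x = cube4 a b c d (a \<cdot> x)" unfolding cube4_rotate x ..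
  also have "\<dots> = a \<cdot> cube4 a b c d x" using V by (simp add: cube4_distrib cube4_fixes_1)
  finally show ?thesis using cancel[of a x "cube4 a b c d x"] V cube4_closed by simp
qed

lemma cube4_fixes:
  assumes V: "a \<in> V" "b \<in> V" "c \<in> V" "d \<in> V" and x: "x \<in> {a, b, c, d}"
  shows "cube4 a b c d x = x"
proof -
  note fx = cube4_fixes_1 cube4_fixes_if_rotated_fixes
  have b: "cube4 a b c d b = b" if "a \<in> V" "b \<in> V" "c \<in> V" "d \<in> V" for a b c d
    by (rule fx(2)[OF that that(2) fx(1)[OF that(2,3,4,1)]])
  have c: "cube4 a b c d c = c" if "a \<in> V" "b \<in> V" "c \<in> V" "d \<in> V" for a b c d
    by (rule fx(2)[OF that that(3) b[OF that(2,3,4,1)]])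
  have d: "cube4 a b c d d = d"
    by (rule fx(2)[OF V V(4) c[OF V(2,3,4,1)]])
  show ?thesis using x fx(1)[OF V] b[OF V] c[OF V] d by (elim insertE) simp_all
qed

lemma L_mult_self: "x \<in> V \<Longrightarrow> L x \<otimes>\<^bsub>Aut\<^esub> L x = \<one>\<^bsub>Aut\<^esub>"
  by (rule aut_eqI) (simp_all add: L_closed aut_apply one_apply invol closed)

lemma inv_L: "x \<in> V \<Longrightarrow> inv\<^bsub>Aut\<^esub> (L x) = L x"
  by (intro A.inv_equality L_mult_self L_closed)

lemma cube4_central:
  assumes V: "a \<in> V" "b \<in> V" "c \<in> V" "d \<in> V" and x: "x \<in> {a, b, c, d}"
  defines "z \<equiv> ((L a \<otimes>\<^bsub>Aut\<^esub> L b) \<otimes>\<^bsub>Aut\<^esub> (L c \<otimes>\<^bsub>Aut\<^esub> L d)) [^]\<^bsub>Aut\<^esub> (3::nat)"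
  shows "z \<otimes>\<^bsub>Aut\<^esub> L x = L x \<otimes>\<^bsub>Aut\<^esub> z"
proof -
  have xV: "x \<in> V" using x V by auto
  have z: "z \<in> carrier Aut" using V by (simp add: z_def L_closed)
  have "z x = cube4 a b c d x"
  proof -
    have "((L a \<otimes>\<^bsub>Aut\<^esub> L b) \<otimes>\<^bsub>Aut\<^esub> (L c \<otimes>\<^bsub>Aut\<^esub> L d)) y = comp4 a b c d y" if "y \<in> V" for y
      using V that by (simp add: aut_apply L_closed closed comp4_def)
    then show ?thesis
      using V xV by (simp add: z_def numeral_3_eq_3 aut_apply L_closed one_apply cube4_def comp4_closed)
  qed
  then show ?thesis using aut_L[OF z xV] cube4_fixes[OF V x] by simp
qed

lemma pairs_p_subgroup:
  assumes V: "a \<in> V" "b \<in> V" "c \<in> V" "d \<in> V"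
  shows "A.p_subgroup 3 (generate Aut {L a \<otimes>\<^bsub>Aut\<^esub> L b, L c \<otimes>\<^bsub>Aut\<^esub> L d})"
proof -
  have cube: "(L x \<otimes>\<^bsub>Aut\<^esub> L y) \<otimes>\<^bsub>Aut\<^esub> (L x \<otimes>\<^bsub>Aut\<^esub> L y) \<otimes>\<^bsub>Aut\<^esub> (L x \<otimes>\<^bsub>Aut\<^esub> L y) = \<one>\<^bsub>Aut\<^esub>"
    if "x \<in> V" "y \<in> V" for x y
    by (rule aut_eqI) (use that in \<open>simp_all add: L_closed aut_apply one_apply closed cube_pair\<close>)
  have inv: "inv\<^bsub>Aut\<^esub> (L c \<otimes>\<^bsub>Aut\<^esub> L d) = L d \<otimes>\<^bsub>Aut\<^esub> L c"
    using V by (simp add: A.inv_mult_group L_closed inv_L)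
  have comm: "w \<otimes>\<^bsub>Aut\<^esub> (L x \<otimes>\<^bsub>Aut\<^esub> L y) = (L x \<otimes>\<^bsub>Aut\<^esub> L y) \<otimes>\<^bsub>Aut\<^esub> w"
    if "w \<in> carrier Aut" "x \<in> V" "y \<in> V" "w \<otimes>\<^bsub>Aut\<^esub> L x = L x \<otimes>\<^bsub>Aut\<^esub> w" "w \<otimes>\<^bsub>Aut\<^esub> L y = L y \<otimes>\<^bsub>Aut\<^esub> w" for w x y
    using that by (metis A.m_assoc L_closed)
  \<comment> \<open>The inverse of L c L d is L d L c, so the second cube required by the 3-group
    criterion is the first one with \<open>c\<close> and \<open>d\<close> exchanged.\<close>
  note c = cube4_central[OF V] cube4_central[OF V(1,2,4,3)]
  show ?thesis
    by (rule A.p_subgroup_3_generate_pair[OF finite_aut _ _ cube cube refl refl])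
      (use V in \<open>auto intro!: comm simp: inv L_closed c\<close>)
qed

text \<open>Products of two translations are closed under conjugation in \<open>Aut\<close>, so
  Baer-Suzuki applies; the resulting 3-group is transitive on \<open>V\<close>.\<close>

theorem card_power_3:
  assumes "V \<noteq> {}"
  shows "\<exists>n. card V = 3 ^ n"
proof -
  define X where "X = {L a \<otimes>\<^bsub>Aut\<^esub> L b | a b. a \<in> V \<and> b \<in> V}"
  have X: "X \<subseteq> carrier Aut" by (auto simp: X_def L_closed)
  have "A.p_subgroup 3 (generate Aut X)"
  proof (rule A.baer_suzuki[OF finite_aut _ X])
    fix g x assume g: "g \<in> carrier Aut" and "x \<in> X"
    then obtain a b where x: "a \<in> V" "b \<in> V" "x = L a \<otimes>\<^bsub>Aut\<^esub> L b" by (auto simp: X_def)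
    have "g \<otimes>\<^bsub>Aut\<^esub> x \<otimes>\<^bsub>Aut\<^esub> inv\<^bsub>Aut\<^esub> g = L (g a) \<otimes>\<^bsub>Aut\<^esub> L (g b)"
    proof -
      have "g \<otimes>\<^bsub>Aut\<^esub> x = (g \<otimes>\<^bsub>Aut\<^esub> L a) \<otimes>\<^bsub>Aut\<^esub> L b" using g x by (simp add: A.m_assoc L_closed)
      also have "\<dots> = L (g a) \<otimes>\<^bsub>Aut\<^esub> (g \<otimes>\<^bsub>Aut\<^esub> L b)"
        unfolding aut_L[OF g x(1)] using g x by (simp add: A.m_assoc L_closed aut_closed)
      also have "\<dots> = L (g a) \<otimes>\<^bsub>Aut\<^esub> L (g b) \<otimes>\<^bsub>Aut\<^esub> g"
        unfolding aut_L[OF g x(2)] using g x by (simp add: A.m_assoc L_closed aut_closed)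
      finally show ?thesis using g x by (simp add: A.m_assoc L_closed aut_closed)
    qed
    then show "g \<otimes>\<^bsub>Aut\<^esub> x \<otimes>\<^bsub>Aut\<^esub> inv\<^bsub>Aut\<^esub> g \<in> X" using g x aut_closed by (auto simp: X_def)
  qed (auto simp: X_def pairs_p_subgroup)
  from A.p_subgroup_card[OF finite_aut _ this] obtain n where n: "card (generate Aut X) = 3 ^ n"
    by auto
  obtain e where e: "e \<in> V" using assms by blast
  have sub: "subgroup (generate Aut X) Aut" by (rule A.generate_is_subgroup[OF X])
  interpret D: group_action "Aut\<lparr>carrier := generate Aut X\<rparr>" V "\<lambda>f. f"
    by (rule group_action.induced_action[OF aut_action sub])
  have "V \<subseteq> orbit (Aut\<lparr>carrier := generate Aut X\<rparr>) (\<lambda>f. f) e"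
  proof
    fix y assume y: "y \<in> V"
    \<comment> \<open>\<open>L e\<close> fixes \<open>e\<close>, and the translation by the third
      point of the block through \<open>e\<close> and \<open>y\<close> takes \<open>e\<close> to
      \<open>y\<close>.\<close>
    have "y = (L (e \<cdot> y) \<otimes>\<^bsub>Aut\<^esub> L e) e"
      using e y by (simp add: aut_apply L_closed closed idem comm[of "e \<cdot> y" e] invol)
    moreover have "L (e \<cdot> y) \<otimes>\<^bsub>Aut\<^esub> L e \<in> generate Aut X"
      using e y closed by (intro generate.incl) (auto simp: X_def)
    ultimately show "y \<in> orbit (Aut\<lparr>carrier := generate Aut X\<rparr>) (\<lambda>f. f) e"
      unfolding orbit_def by auto
  qed
  then have "orbit (Aut\<lparr>carrier := generate Aut X\<rparr>) (\<lambda>f. f) e = V"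
    using e aut_closed subgroup.mem_carrier[OF sub] by (auto simp: orbit_def)
  then have "card V dvd 3 ^ n"
    using D.orbit_stabilizer_theorem[OF e] n by (metis dvd_triv_left order_def partial_object.select_convs(1) partial_object.surjective partial_object.update_convs(1))
  then show ?thesis using divides_primepow_nat[of 3] by auto
qed

end

section \<open>Distributive Mendelsohn quasigroups\<close>

context distributive_mendelsohn_quasigroup
begin

section \<open>Word identities from distributivity and semisymmetry\<close>

lemma semisymmetric_left: "x \<in> V \<Longrightarrow> y \<in> V \<Longrightarrow> (x \<star> y) \<star> x = y"
  by (metis closed left_division semisymmetric)

lemma star_conjugate_left: "x \<in> V \<Longrightarrow> y \<in> V \<Longrightarrow> z \<in> V \<Longrightarrow> x \<star> ((y \<star> x) \<star> z) = y \<star> (x \<star> z)"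
  by (metis closed left_distributive semisymmetric)

lemma star_fold: "x \<in> V \<Longrightarrow> y \<in> V \<Longrightarrow> z \<in> V \<Longrightarrow> x \<star> (y \<star> (z \<star> x)) = (x \<star> y) \<star> z"
  by (metis closed left_distributive semisymmetric)

lemma star_cross_left: "x \<in> V \<Longrightarrow> y \<in> V \<Longrightarrow> z \<in> V \<Longrightarrow> (x \<star> y) \<star> (z \<star> x) = ((x \<star> y) \<star> z) \<star> y"
  by (metis closed left_distributive semisymmetric_left)

lemma star_divide: "x \<in> V \<Longrightarrow> y \<in> V \<Longrightarrow> z \<in> V \<Longrightarrow> (x \<star> (y \<star> z)) \<star> (x \<star> y) = x \<star> z"
  by (metis closed left_distributive semisymmetric_left)

lemma star_cross_right: "x \<in> V \<Longrightarrow> y \<in> V \<Longrightarrow> z \<in> V \<Longrightarrow> (x \<star> y) \<star> (z \<star> x) = z \<star> (y \<star> (z \<star> x))"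
  by (metis closed right_distributive semisymmetric)

lemma star_rotate: "x \<in> V \<Longrightarrow> y \<in> V \<Longrightarrow> z \<in> V \<Longrightarrow> ((x \<star> y) \<star> z) \<star> x = y \<star> (z \<star> x)"
  by (metis closed right_distributive semisymmetric_left)

lemma star_expand:
  assumes V: "x \<in> V" "y \<in> V" "z \<in> V"
  shows "(z \<star> y) \<star> ((x \<star> z) \<star> z) = x \<star> (y \<star> z)"
proof -
  have "(z \<star> y) \<star> ((x \<star> z) \<star> z) = ((z \<star> y) \<star> (x \<star> z)) \<star> y"
    using V by (simp add: star_cross_left closed)
  also have "\<dots> = (x \<star> (y \<star> (x \<star> z))) \<star> y" using V by (simp add: star_cross_right)
  also have "\<dots> = x \<star> ((y \<star> (x \<star> z)) \<star> (y \<star> x))"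
    by (rule star_fold[symmetric]) (use V closed in simp_all)
  also have "\<dots> = x \<star> (y \<star> z)" using V by (simp add: star_divide)
  finally show ?thesis .
qed

text \<open>Right multiplication by \<open>z\<close> inverts left multiplication by
  \<open>z\<close>. The identity trades inverse translations for direct ones, so that the
  commutation below becomes a statement about left translations alone.\<close>

lemma double_right_eq:
  assumes V: "x \<in> V" "y \<in> V" "z \<in> V"
  shows "((x \<star> y) \<star> z) \<star> z = y \<star> (z \<star> (z \<star> x))"
proof -
  let ?p = "(x \<star> y) \<star> z"
  have p: "?p \<in> V" using V closed by simp
  have "?p \<star> z = (?p \<star> (x \<star> z)) \<star> (?p \<star> x)" using star_divide[OF p V(1,3)] by simp
  also have "?p \<star> (x \<star> z) = y \<star> z"
    using V semisymmetric_left[of "x \<star> z" "y \<star> z"] by (simp add: right_distributive[of x y z] closed)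
  also have "?p \<star> x = y \<star> (z \<star> x)" using V by (rule star_rotate)
  also have "(y \<star> z) \<star> (y \<star> (z \<star> x)) = y \<star> (z \<star> (z \<star> x))"
    using V by (simp add: left_distributive[of y z "z \<star> x"] closed)
  finally show ?thesis .
qed

lemma star_absorb:
  assumes V: "x \<in> V" "y \<in> V" "z \<in> V"
  shows "x \<star> ((y \<star> z) \<star> (x \<star> y)) = (y \<star> x) \<star> z"
proof -
  have "(y \<star> z) \<star> (x \<star> y) = ((y \<star> z) \<star> x) \<star> z" by (rule star_cross_left[OF V(2,3,1)])
  then have "x \<star> ((y \<star> z) \<star> (x \<star> y)) = (y \<star> z) \<star> (x \<star> z)" using V by (simp add: star_conjugate_left closed)
  then show ?thesis using V by (simp add: right_distributive)
qed

text \<open>Both sides reduce to \<open>(x \<star> z) \<star> ((x \<star> y) \<star> z)\<close>. It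
  serves to pull a letter out of a squared translation as a right multiplication.\<close>

lemma left_square_commute:
  assumes V: "x \<in> V" "y \<in> V" "z \<in> V"
  shows "(x \<star> (x \<star> y)) \<star> z = (x \<star> (x \<star> z)) \<star> y"
proof -
  have "(x \<star> (x \<star> z)) \<star> y = ((((y \<star> x) \<star> y)) \<star> (x \<star> z)) \<star> y" using V by (simp add: semisymmetric_left)
  also have "\<dots> = (x \<star> z) \<star> (y \<star> ((x \<star> z) \<star> (y \<star> x)))"
    using V star_cross_left[of "y \<star> x" y "x \<star> z"] star_cross_right[of "y \<star> x" y "x \<star> z"] by (simp add: closed)
  also have "\<dots> = (x \<star> z) \<star> ((x \<star> y) \<star> z)" using V by (simp add: star_absorb)
  also have "\<dots> = (x \<star> (x \<star> y)) \<star> z" using V right_distributive[of x "x \<star> y" z] by (simp add: closed)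
  finally show ?thesis by simp
qed

lemma double_right_star:
  assumes V: "x \<in> V" "y \<in> V" "z \<in> V"
  shows "((z \<star> x) \<star> x) \<star> (z \<star> y) = x \<star> (x \<star> y)"
proof -
  let ?u = "z \<star> x"
  \<comment> \<open>Writing \<open>y\<close> as \<open>x \<star> (y \<star> x)\<close> exposes
    \<open>?u\<close> as a left factor of \<open>z \<star> y\<close>.\<close>
  have "((z \<star> x) \<star> x) \<star> (z \<star> y) = (?u \<star> x) \<star> (?u \<star> (z \<star> (y \<star> x)))"
    using V left_distributive[of z x "y \<star> x"] by (simp add: semisymmetric closed)
  also have "z \<star> (y \<star> x) = (x \<star> y) \<star> (?u \<star> x)" using V by (simp add: star_expand)
  also have "?u \<star> ((x \<star> y) \<star> (?u \<star> x)) = (x \<star> (x \<star> y)) \<star> (?u \<star> x)"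
    using V by (simp add: star_cross_right closed)
  also have "(?u \<star> x) \<star> \<dots> = x \<star> (x \<star> y)" using V by (simp add: semisymmetric closed)
  finally show ?thesis .
qed

lemma left_square_star:
  assumes V: "x \<in> V" "y \<in> V" "z \<in> V"
  shows "(x \<star> (x \<star> z)) \<star> (y \<star> z) = x \<star> (y \<star> (z \<star> (z \<star> x)))"
proof -
  let ?r = "y \<star> z"
  \<comment> \<open>The square is expanded so that \<open>?r\<close> occurs twice on the right, the
    shape that \<open>double_right_eq\<close> expects.\<close>
  have "(x \<star> (x \<star> z)) \<star> ?r = (((y \<star> x) \<star> x) \<star> ?r) \<star> ?r" using V by (simp add: double_right_star)
  also have "\<dots> = x \<star> (?r \<star> (?r \<star> (y \<star> x)))" using V by (intro double_right_eq closed)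
  also have "?r \<star> (?r \<star> (y \<star> x)) = y \<star> (z \<star> (z \<star> x))"
    using V by (simp add: left_distributive[of y z x] left_distributive[of y z "z \<star> x"] closed)
  finally show ?thesis .
qed

text \<open>With the word after \<open>w\<close> on the right written as
  \<open>?p \<star> ?q\<close>, \<open>star_expand\<close> splits off the factor
  \<open>?q \<star> ?p\<close>, which collapses to \<open>y\<close>. Left multiplication by
  \<open>y\<close> then passes across two multiplications by \<open>x \<star> y\<close> and turns
  both into multiplications by \<open>x\<close>.\<close>

lemma square_exchange:
  assumes V: "x \<in> V" "y \<in> V" "z \<in> V" "w \<in> V"
  shows "x \<star> (x \<star> (y \<star> (z \<star> (z \<star> w)))) = w \<star> (x \<star> (y \<star> (z \<star> (z \<star> x))))"
proof -
  let ?u = "x \<star> y" and ?q = "(x \<star> y) \<star> z" and ?p = "x \<star> (y \<star> z)"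
  have [simp]: "?u \<in> V" "?q \<in> V" "?p \<in> V" using V closed by auto
  note [simp] = V closed
  have "x \<star> (y \<star> (z \<star> (z \<star> x))) = x \<star> ((y \<star> z) \<star> (y \<star> (z \<star> x)))"
    by (simp add: left_distributive[of y z "z \<star> x"])
  also have "\<dots> = ?p \<star> (x \<star> (y \<star> (z \<star> x)))" by (rule left_distributive) simp_all
  also have "\<dots> = ?p \<star> ?q" by (simp add: star_fold)
  finally have "w \<star> (x \<star> (y \<star> (z \<star> (z \<star> x)))) = w \<star> (?p \<star> ?q)" by simp
  also have "\<dots> = (?q \<star> ?p) \<star> ((w \<star> ?q) \<star> ?q)" by (rule star_expand[symmetric]) simp_all
  also have "?q \<star> ?p = y"
    using semisymmetric[of ?q y] star_conjugate_left[of y x z] by simp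
  also have "(w \<star> ?q) \<star> ?q = ?u \<star> (((w \<star> ?u) \<star> z) \<star> z)"
    using left_distributive[of ?u "(w \<star> ?u) \<star> z" z] by (simp add: star_conjugate_left)
  also have "\<dots> = ?u \<star> (?u \<star> (z \<star> (z \<star> w)))" by (simp add: double_right_eq)
  also have "y \<star> \<dots> = x \<star> (x \<star> (y \<star> (z \<star> (z \<star> w))))" by (simp add: star_conjugate_left)
  finally show ?thesis by simp
qed

text \<open>Since right multiplication by \<open>e\<close> is the inverse of L e, replacing
  \<open>y\<close> by \<open>y \<star> e\<close> shows that (L a)^2 (L e)^-2 commutes with L b (L
  e)^-1.\<close>

lemma square_displacement_commute:
  assumes V: "a \<in> V" "b \<in> V" "e \<in> V" "y \<in> V"
  shows "a \<star> (a \<star> (((b \<star> y) \<star> e) \<star> e)) = b \<star> ((a \<star> (a \<star> (y \<star> e))) \<star> e)"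
proof -
  note [simp] = V closed
  have "a \<star> (a \<star> (((b \<star> y) \<star> e) \<star> e)) = a \<star> (a \<star> (y \<star> (e \<star> (e \<star> b))))" by (simp add: double_right_eq)
  also have "\<dots> = b \<star> (a \<star> (y \<star> (e \<star> (e \<star> a))))" by (rule square_exchange) simp_all
  also have "a \<star> (y \<star> (e \<star> (e \<star> a))) = (a \<star> (a \<star> e)) \<star> (y \<star> e)" by (simp add: left_square_star)
  also have "\<dots> = (a \<star> (a \<star> (y \<star> e))) \<star> e" by (rule left_square_commute) simp_all
  finally show ?thesis .
qed

end

section \<open>The displacement group and its centre\<close>

locale finite_distributive_mendelsohn_quasigroup = distributive_mendelsohn_quasigroup +
  assumes finite_V: "finite V"
begin

sublocale finite_quandle V comp
proof
  show "bij_betw (\<lambda>y. x \<star> y) V V" if "x \<in> V" for x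
    by (rule bij_betw_byWitness[of V "\<lambda>y. y \<star> x"]) (use that in \<open>auto simp: closed semisymmetric semisymmetric_left\<close>)
qed (fact finite_V closed idempotent left_distributive)+

abbreviation aut_mult (infixl "\<odot>" 70) where "f \<odot> g \<equiv> f \<otimes>\<^bsub>Aut\<^esub> g"
abbreviation aut_inv where "aut_inv f \<equiv> inv\<^bsub>Aut\<^esub> f"

lemma inv_L_apply:
  assumes "x \<in> V" "y \<in> V"
  shows "aut_inv (L x) y = y \<star> x"
proof -
  have L: "L x \<in> carrier Aut" using assms L_closed by simp
  have "(aut_inv (L x) \<odot> L x) (y \<star> x) = aut_inv (L x) (L x (y \<star> x))"
    using assms L by (intro aut_apply) (simp_all add: closed)
  moreover have "L x (y \<star> x) = y" using assms by (simp add: closed semisymmetric)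
  ultimately show ?thesis using assms L by (simp add: one_apply closed)
qed

definition displacements where "displacements = {L a \<odot> aut_inv (L b) | a b. a \<in> V \<and> b \<in> V}"

definition D where "D = generate Aut displacements"

definition Z where "Z = {g \<in> D. \<forall>d\<in>D. g \<odot> d = d \<odot> g}"

lemma displacements_subset: "displacements \<subseteq> carrier Aut"
  by (auto simp: displacements_def L_closed)

lemma subgroup_D: "subgroup D Aut"
  unfolding D_def by (rule A.generate_is_subgroup[OF displacements_subset])

lemma D_carrier: "d \<in> D \<Longrightarrow> d \<in> carrier Aut"
  using subgroup.mem_carrier[OF subgroup_D] .

lemma Z_carrier: "g \<in> Z \<Longrightarrow> g \<in> carrier Aut"
  using D_carrier by (simp add: Z_def)

lemma conj_mult:
  assumes "f \<in> carrier Aut" "g \<in> carrier Aut" "h \<in> carrier Aut"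
  shows "f \<odot> (g \<odot> h) \<odot> aut_inv f = (f \<odot> g \<odot> aut_inv f) \<odot> (f \<odot> h \<odot> aut_inv f)"
  using assms by (simp add: A.m_assoc A.inv_cancel_left)

lemma conj_inv:
  assumes "f \<in> carrier Aut" "g \<in> carrier Aut"
  shows "f \<odot> aut_inv g \<odot> aut_inv f = aut_inv (f \<odot> g \<odot> aut_inv f)"
  using assms by (simp add: A.m_assoc A.inv_mult_group)

lemma conj_displacements:
  assumes f: "f \<in> carrier Aut" and d: "d \<in> displacements"
  shows "f \<odot> d \<odot> aut_inv f \<in> displacements"
proof -
  obtain a b where ab: "a \<in> V" "b \<in> V" "d = L a \<odot> aut_inv (L b)" using d by (auto simp: displacements_def)
  then have "f \<odot> d \<odot> aut_inv f = L (f a) \<odot> aut_inv (L (f b))"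
    using f by (simp only: conj_mult conj_inv conj_L L_closed A.inv_closed)
  then show ?thesis using ab f aut_closed by (auto simp: displacements_def)
qed

lemma conj_D:
  assumes f: "f \<in> carrier Aut" and d: "d \<in> D"
  shows "f \<odot> d \<odot> aut_inv f \<in> D"
  using d unfolding D_def
proof (induction rule: generate.induct)
  case one
  then show ?case using f generate.one[of Aut] by simp
next
  case (incl h)
  then show ?case by (intro generate.incl conj_displacements[OF f])
next
  case (inv h)
  then have "h \<in> carrier Aut" using displacements_subset by blast
  then show ?case
    unfolding conj_inv[OF f \<open>h \<in> carrier Aut\<close>] by (intro generate.inv conj_displacements[OF f inv])
next
  case (eng h1 h2)
  then have "h1 \<in> carrier Aut" "h2 \<in> carrier Aut" using D_carrier by (simp_all add: D_def)
  then show ?case using generate.eng[OF eng.IH] by (simp only: conj_mult[OF f])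
qed

lemma ZI:
  assumes g: "g \<in> D" and comm: "\<And>d. d \<in> displacements \<Longrightarrow> g \<odot> d = d \<odot> g"
  shows "g \<in> Z"
proof -
  have gA: "g \<in> carrier Aut" using D_carrier[OF g] .
  have "g \<odot> d = d \<odot> g" if "d \<in> D" for d
    using that unfolding D_def
  proof (induction rule: generate.induct)
    case one
    then show ?case using gA by simp
  next
    case (incl h)
    then show ?case by (rule comm)
  next
    case (inv h)
    then have h: "h \<in> carrier Aut" using displacements_subset by blast
    have "aut_inv h \<odot> (g \<odot> h) \<odot> aut_inv h = aut_inv h \<odot> (h \<odot> g) \<odot> aut_inv h"
      using comm[OF inv] by simp
    then show ?case using h gA by (simp add: A.m_assoc A.inv_cancel_left)
  next
    case (eng h1 h2)
    then have "h1 \<in> carrier Aut" "h2 \<in> carrier Aut" using D_carrier by (simp_all add: D_def)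
    then show ?case using eng.IH gA by (metis A.m_assoc)
  qed
  then show ?thesis using g by (simp add: Z_def)
qed

lemma subgroup_Z: "subgroup Z Aut"
proof (rule A.subgroupI)
  show "Z \<subseteq> carrier Aut" using Z_carrier by blast
  have "\<one>\<^bsub>Aut\<^esub> \<in> Z" using subgroup.one_closed[OF subgroup_D] D_carrier by (simp add: Z_def)
  then show "Z \<noteq> {}" by blast
  fix g assume g: "g \<in> Z"
  then have gD: "g \<in> D" "g \<in> carrier Aut" using Z_carrier by (auto simp: Z_def)
  show "aut_inv g \<in> Z"
  proof (rule ZI)
    show "aut_inv g \<in> D" using gD(1) subgroup.m_inv_closed[OF subgroup_D] by blast
    fix d assume d: "d \<in> displacements"
    then have dA: "d \<in> carrier Aut" and dD: "d \<in> D" using displacements_subset generate.incl by (auto simp: D_def)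
    have "g \<odot> d = d \<odot> g" using g dD by (simp add: Z_def)
    then have "aut_inv g \<odot> (g \<odot> d) \<odot> aut_inv g = aut_inv g \<odot> (d \<odot> g) \<odot> aut_inv g" by simp
    then show "aut_inv g \<odot> d = d \<odot> aut_inv g" using gD(2) dA by (simp add: A.m_assoc A.inv_cancel_left)
  qed
  fix h assume h: "h \<in> Z"
  then have hD: "h \<in> D" "h \<in> carrier Aut" using Z_carrier by (auto simp: Z_def)
  show "g \<odot> h \<in> Z"
  proof (rule ZI)
    show "g \<odot> h \<in> D" using gD(1) hD(1) subgroup.m_closed[OF subgroup_D] by blast
    fix d assume "d \<in> displacements"
    then have dA: "d \<in> carrier Aut" and dD: "d \<in> D" using displacements_subset generate.incl by (auto simp: D_def)
    have "g \<odot> h \<odot> d = g \<odot> (d \<odot> h)" using h dD gD hD dA by (simp add: Z_def A.m_assoc)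
    also have "\<dots> = (d \<odot> g) \<odot> h" using g dD gD hD dA by (simp add: Z_def A.m_assoc[symmetric])
    finally show "g \<odot> h \<odot> d = d \<odot> (g \<odot> h)" using gD hD dA by (simp add: A.m_assoc)
  qed
qed

lemma conj_Z:
  assumes f: "f \<in> carrier Aut" and g: "g \<in> Z"
  shows "f \<odot> g \<odot> aut_inv f \<in> Z"
proof (rule ZI)
  have gD: "g \<in> D" "g \<in> carrier Aut" using g Z_carrier by (auto simp: Z_def)
  show "f \<odot> g \<odot> aut_inv f \<in> D" using conj_D[OF f gD(1)] .
  fix d assume d: "d \<in> displacements"
  then have dA: "d \<in> carrier Aut" using displacements_subset by blast
  \<comment> \<open>Pulling \<open>d\<close> back along \<open>f\<close> reduces the claim to
    \<open>g\<close> commuting with another displacement.\<close>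
  define d' where "d' = aut_inv f \<odot> d \<odot> f"
  have "aut_inv f \<odot> d \<odot> aut_inv (aut_inv f) \<in> displacements"
    using conj_displacements[OF _ d, of "aut_inv f"] f by blast
  then have "d' \<in> displacements" using f by (simp add: d'_def)
  then have d': "d' \<in> D" "d' \<in> carrier Aut"
    unfolding D_def using displacements_subset by (auto intro: generate.incl)
  have d_eq: "d = f \<odot> d' \<odot> aut_inv f" using f dA by (simp add: d'_def A.m_assoc A.inv_cancel_left)
  have "g \<odot> d' = d' \<odot> g" using g d' by (simp add: Z_def)
  then show "f \<odot> g \<odot> aut_inv f \<odot> d = d \<odot> (f \<odot> g \<odot> aut_inv f)"
    unfolding d_eq conj_mult[OF f gD(2) d'(2), symmetric] conj_mult[OF f d'(2) gD(2), symmetric] by simp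
qed

lemma D_transitive:
  assumes "x \<in> V" "y \<in> V"
  shows "\<exists>d\<in>D. d x = y"
proof
  \<comment> \<open>The inverse of \<open>L x\<close> fixes \<open>x\<close> by idempotence, and
    \<open>(x \<star> y) \<star> x = y\<close>.\<close>
  have "x \<star> y \<in> V" using assms closed by simp
  then show "L (x \<star> y) \<odot> aut_inv (L x) \<in> D"
    unfolding D_def using assms by (intro generate.incl) (auto simp: displacements_def)
  show "(L (x \<star> y) \<odot> aut_inv (L x)) x = y"
    using assms by (simp add: aut_apply L_closed closed inv_L_apply idempotent semisymmetric_left)
qed

text \<open>An element commuting with a transitive group is determined by its value at one
  point.\<close>

lemma Z_eqI:
  assumes g: "g \<in> Z" and h: "h \<in> Z" and x: "x \<in> V" "g x = h x"
  shows "g = h"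
proof (rule aut_eqI)
  show gA: "g \<in> carrier Aut" and hA: "h \<in> carrier Aut" using g h Z_carrier by auto
  fix y assume "y \<in> V"
  then obtain d where d: "d \<in> D" "d x = y" using D_transitive x by blast
  then have dA: "d \<in> carrier Aut" using D_carrier by blast
  have move: "k y = d (k x)" if "k \<in> Z" for k
    using that d x dA aut_apply[of k d x] aut_apply[of d k x] Z_carrier[OF that] by (auto simp: Z_def)
  show "g y = h y" using move[OF g] move[OF h] x(2) by simp
qed

lemma squares_in_Z:
  assumes a: "a \<in> V" and e: "e \<in> V"
  shows "L a \<odot> (L a \<odot> (aut_inv (L e) \<odot> aut_inv (L e))) \<in> Z" (is "?t \<in> Z")
proof (rule ZI)
  note [simp] = L_closed closed aut_apply aut_closed inv_L_apply
  have gen: "L x \<odot> aut_inv (L y) \<in> D" if "x \<in> V" "y \<in> V" for x y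
    unfolding D_def using that by (intro generate.incl) (auto simp: displacements_def)
  \<comment> \<open>The element is the displacement L a (L e)^-1 multiplied on the left by its
    conjugate under \<open>L a\<close>, hence lies in \<open>D\<close>.\<close>
  have "L a \<odot> (L a \<odot> aut_inv (L e)) \<odot> aut_inv (L a) \<in> D" "L a \<odot> aut_inv (L e) \<in> D"
    using a e gen by (auto intro: conj_D)
  then have "L a \<odot> (L a \<odot> aut_inv (L e)) \<odot> aut_inv (L a) \<odot> (L a \<odot> aut_inv (L e)) \<in> D"
    using subgroup.m_closed[OF subgroup_D] by blast
  then show tD: "?t \<in> D" using a e by (simp add: A.m_assoc A.inv_cancel_left)
  have comm: "?t \<odot> (L b \<odot> aut_inv (L e)) = (L b \<odot> aut_inv (L e)) \<odot> ?t" if b: "b \<in> V" for b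
  proof (rule aut_eqI)
    fix y assume y: "y \<in> V"
    then have "a \<star> (a \<star> (((b \<star> (y \<star> e)) \<star> e) \<star> e)) = b \<star> ((a \<star> (a \<star> ((y \<star> e) \<star> e))) \<star> e)"
      using a b e by (intro square_displacement_commute) auto
    then show "(?t \<odot> (L b \<odot> aut_inv (L e))) y = (L b \<odot> aut_inv (L e) \<odot> ?t) y"
      using a b e y by simp
  qed (use a b e in auto)
  fix d assume "d \<in> displacements"
  then obtain b c where bc: "b \<in> V" "c \<in> V" "d = L b \<odot> aut_inv (L c)" by (auto simp: displacements_def)
  \<comment> \<open>\<open>comm\<close> covers only displacements based at the same point
    \<open>e\<close>; an arbitrary one is a quotient of two of these.\<close>
  define B where "B = L b \<odot> aut_inv (L e)"
  define C where "C = L c \<odot> aut_inv (L e)"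
  have [simp]: "B \<in> carrier Aut" "C \<in> carrier Aut" "?t \<in> carrier Aut" using a e bc by (auto simp: B_def C_def)
  have d: "d = B \<odot> aut_inv C" using bc e by (simp add: B_def C_def A.inv_mult_group A.m_assoc A.inv_cancel_left)
  have tB: "?t \<odot> B = B \<odot> ?t" and tC: "?t \<odot> C = C \<odot> ?t" using comm bc by (auto simp: B_def C_def)
  have tC': "?t \<odot> aut_inv C = aut_inv C \<odot> ?t"
  proof -
    have "aut_inv C \<odot> (?t \<odot> C) \<odot> aut_inv C = aut_inv C \<odot> (C \<odot> ?t) \<odot> aut_inv C" by (simp only: tC)
    then show ?thesis by (simp del: L_closed add: A.m_assoc A.inv_cancel_left)
  qed
  have "?t \<odot> d = (?t \<odot> B) \<odot> aut_inv C" unfolding d by (rule A.m_assoc[symmetric]) simp_all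
  also have "\<dots> = B \<odot> (?t \<odot> aut_inv C)" unfolding tB by (rule A.m_assoc) simp_all
  also have "\<dots> = d \<odot> ?t" unfolding tC' d by (rule A.m_assoc[symmetric]) simp_all
  finally show "?t \<odot> d = d \<odot> ?t" .
qed

section \<open>The quotient by the orbits of the centre\<close>

definition cls where "cls x = orbit (Aut\<lparr>carrier := Z\<rparr>) (\<lambda>f. f) x"

text \<open>A product of sets, so that no representatives are chosen; \<open>cls_mult\<close> below
  shows that it is again a single orbit.\<close>

definition cls_mult where "cls_mult X Y = {x \<star> y | x y. x \<in> X \<and> y \<in> Y}"

lemma Z_action: "group_action (Aut\<lparr>carrier := Z\<rparr>) V (\<lambda>f. f)"
  by (rule group_action.induced_action[OF aut_action subgroup_Z])

lemma cls: "cls x = {g x | g. g \<in> Z}"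
  by (simp add: cls_def orbit_def)

lemma cls_subset: "x \<in> V \<Longrightarrow> cls x \<subseteq> V"
  using Z_carrier aut_closed by (auto simp: cls)

lemma cls_self: "x \<in> V \<Longrightarrow> x \<in> cls x"
  unfolding cls_def by (rule group_action.orbit_refl[OF Z_action])

lemma cls_partition: "partition V (cls ` V)"
proof -
  have "orbits (Aut\<lparr>carrier := Z\<rparr>) V (\<lambda>f. f) = cls ` V" by (auto simp: orbits_def cls_def)
  then show ?thesis using group_action.orbit_partition[OF Z_action] by simp
qed

lemma cls_eqI: "x \<in> V \<Longrightarrow> y \<in> V \<Longrightarrow> x \<in> cls y \<Longrightarrow> cls x = cls y"
  using partition.disjoint_union[OF cls_partition, of "cls x" "cls y"] cls_self by blast

text \<open>Pulling \<open>g\<close> out of \<open>g x \<star> h y\<close> leaves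
  \<open>x \<star> k y\<close>, and moving \<open>k\<close> across \<open>L x\<close> replaces it by
  its conjugate, again in \<open>Z\<close>.\<close>

lemma cls_mult:
  assumes x: "x \<in> V" and y: "y \<in> V"
  shows "cls_mult (cls x) (cls y) = cls (x \<star> y)"
proof
  show "cls_mult (cls x) (cls y) \<subseteq> cls (x \<star> y)"
  proof
    fix w assume "w \<in> cls_mult (cls x) (cls y)"
    then obtain g h where gh: "g \<in> Z" "h \<in> Z" "w = g x \<star> h y" by (auto simp: cls_mult_def cls)
    then have A: "g \<in> carrier Aut" "h \<in> carrier Aut" using Z_carrier by auto
    define k where "k = aut_inv g \<odot> h"
    have k: "k \<in> Z" using gh subgroup.m_closed[OF subgroup_Z] subgroup.m_inv_closed[OF subgroup_Z] by (simp add: k_def)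
    then have kA: "k \<in> carrier Aut" using Z_carrier by blast
    define l where "l = g \<odot> (L x \<odot> k \<odot> aut_inv (L x))"
    have l: "l \<in> Z" unfolding l_def
      using gh(1) conj_Z[OF L_closed[OF x] k] subgroup.m_closed[OF subgroup_Z] by blast
    have h: "h = g \<odot> k" using A by (simp add: k_def A.inv_cancel_left)
    have "aut_inv (L x) (x \<star> y) = y" using x y by (simp add: inv_L_apply closed semisymmetric_left)
    then have "l (x \<star> y) = g (x \<star> k y)"
      using x y A kA by (simp add: l_def aut_apply L_closed aut_closed closed)
    also have "\<dots> = w" unfolding gh(3) h using x y A kA by (simp add: aut_hom aut_closed aut_apply)
    finally show "w \<in> cls (x \<star> y)" using l by (auto simp: cls)
  qed
  show "cls (x \<star> y) \<subseteq> cls_mult (cls x) (cls y)"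
  proof
    fix w assume "w \<in> cls (x \<star> y)"
    then obtain g where g: "g \<in> Z" "w = g (x \<star> y)" by (auto simp: cls)
    then have "w = g x \<star> g y" using x y Z_carrier aut_hom by simp
    then show "w \<in> cls_mult (cls x) (cls y)" using g(1) unfolding cls_mult_def cls by blast
  qed
qed

lemma cls_square:
  assumes x: "x \<in> V" and y: "y \<in> V"
  shows "cls (x \<star> (x \<star> y)) = cls y"
proof (rule cls_eqI)
  let ?g = "L x \<odot> (L x \<odot> (aut_inv (L y) \<odot> aut_inv (L y)))"
  \<comment> \<open>The two inverse factors fix \<open>y\<close> by idempotence, so only the square
    of \<open>L x\<close> acts.\<close>
  have "?g y = x \<star> (x \<star> y)"
    using x y by (simp add: aut_apply L_closed closed aut_closed inv_L_apply idempotent)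
  then show "x \<star> (x \<star> y) \<in> cls y" using squares_in_Z[OF x y] unfolding cls
    by (intro CollectI exI[of _ ?g]) simp
qed (use x y closed in auto)

text \<open>Semisymmetry gives \<open>x \<star> (x \<star> (y \<star> x)) = x \<star> y\<close>, so
  this is \<open>cls_square\<close> at \<open>y \<star> x\<close>.\<close>

lemma cls_commute:
  assumes x: "x \<in> V" and y: "y \<in> V"
  shows "cls (x \<star> y) = cls (y \<star> x)"
  using cls_square[OF x closed[OF y x]] x y by (simp add: semisymmetric)

lemma classes_hall_triple_system: "hall_triple_system (cls ` V) cls_mult"
proof
  show "finite (cls ` V)" using finite_V by simp
qed (auto simp: cls_mult closed idempotent cls_square cls_commute left_distributive[symmetric])

lemma card_V:
  assumes "V \<noteq> {}"
  shows "\<exists>n. card V = 3 ^ n * card Z"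
proof -
  obtain n where n: "card (cls ` V) = 3 ^ n"
    using hall_triple_system.card_power_3[OF classes_hall_triple_system] assms by auto
  have "card Z * card (cls ` V) = card (\<Union> (cls ` V))"
  proof (rule card_partition)
    show "finite (cls ` V)" using finite_V by simp
    show "finite (\<Union> (cls ` V))" using finite_V cls_subset finite_subset[of "\<Union> (cls ` V)" V] by blast
    show "card c = card Z" if c: "c \<in> cls ` V" for c
    proof -
      obtain x where x: "x \<in> V" "c = cls x" using c by blast
      have "c = (\<lambda>g. g x) ` Z" using x by (auto simp: cls)
      moreover have "inj_on (\<lambda>g. g x) Z" using Z_eqI x by (auto intro: inj_onI)
      ultimately show ?thesis by (simp add: card_image)
    qed
    show "c1 \<inter> c2 = {}" if "c1 \<in> cls ` V" "c2 \<in> cls ` V" "c1 \<noteq> c2" for c1 c2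
      using partition.disjoint_union[OF cls_partition] that by blast
  qed
  moreover have "\<Union> (cls ` V) = V" using partition.partition_coverture[OF cls_partition] .
  ultimately show ?thesis using n by (metis mult.commute)
qed

section \<open>The Eisenstein action on the centre\<close>

lemma even_multiplicity_card_Z:
  assumes "V \<noteq> {}" and q: "prime q" "[q = 2] (mod 3)"
  shows "even (multiplicity q (card Z))"
proof -
  obtain e where e: "e \<in> V" using assms(1) by blast
  define GZ where "GZ = Aut\<lparr>carrier := Z\<rparr>"
  interpret GZ: group GZ unfolding GZ_def by (rule A.subgroup_imp_group[OF subgroup_Z])
  interpret GZ: comm_group GZ
  proof (rule GZ.group_comm_groupI)
    fix g h assume "g \<in> carrier GZ" "h \<in> carrier GZ"
    then have "g \<in> Z" "h \<in> D" by (simp_all add: GZ_def Z_def)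
    then have "g \<odot> h = h \<odot> g" unfolding Z_def by blast
    then show "g \<otimes>\<^bsub>GZ\<^esub> h = h \<otimes>\<^bsub>GZ\<^esub> g" by (simp add: GZ_def)
  qed
  have Le: "L e \<in> carrier Aut" using e L_closed by blast
  define \<phi> where "\<phi> g = L e \<odot> g \<odot> aut_inv (L e)" for g
  have \<phi>Z: "\<phi> g \<in> Z" if "g \<in> Z" for g unfolding \<phi>_def by (rule conj_Z[OF Le that])
  \<comment> \<open>When \<open>Z\<close> is identified with the orbit of \<open>e\<close> by
    evaluation, \<phi> becomes left multiplication by \<open>e\<close>.\<close>
  have \<phi>_apply: "\<phi> g e = e \<star> g e" if "g \<in> Z" for g
    using that e Le Z_carrier[OF that] by (simp add: \<phi>_def aut_apply aut_closed inv_L_apply closed idempotent)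
  have mult: "g \<odot> h \<in> Z" "aut_inv g \<in> Z" if "g \<in> Z" "h \<in> Z" for g h
    using that subgroup.m_closed[OF subgroup_Z] subgroup.m_inv_closed[OF subgroup_Z] by auto
  have \<phi>_mult: "\<phi> (g \<odot> h) = \<phi> g \<odot> \<phi> h" if "g \<in> Z" "h \<in> Z" for g h
    unfolding \<phi>_def using conj_mult Le Z_carrier that by blast
  have \<phi>_inv: "\<phi> (aut_inv g) = aut_inv (\<phi> g)" if "g \<in> Z" for g
    unfolding \<phi>_def using conj_inv Le Z_carrier that by blast
  have rel: "\<phi> (\<phi> g) \<odot> g = \<phi> g" if g: "g \<in> Z" for g
  proof -
    have gA: "g \<in> carrier Aut" using g Z_carrier by blast
    \<comment> \<open>Chosen so that \<open>h e = g e \<star> e\<close>. Then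
      \<open>\<phi> h e = e \<star> (g e \<star> e) = g e\<close>, hence
      \<open>\<phi> h = g\<close>, which is the relation rearranged.\<close>
    define h where "h = g \<odot> aut_inv (\<phi> g)"
    have h: "h \<in> Z" unfolding h_def using g \<phi>Z mult by blast
    have gi: "aut_inv g \<in> Z" "aut_inv g \<in> carrier Aut" using g gA mult by auto
    have "h e = g (\<phi> (aut_inv g) e)"
      using g gA e \<phi>Z[OF gi(1)] Z_carrier by (simp add: h_def \<phi>_inv[symmetric] aut_apply)
    also have "\<dots> = g (e \<star> aut_inv g e)" using gi by (simp add: \<phi>_apply)
    also have "\<dots> = g e \<star> g (aut_inv g e)" by (rule aut_hom[OF gA e aut_closed[OF gi(2) e]])
    also have "g (aut_inv g e) = (g \<odot> aut_inv g) e"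
      by (rule aut_apply[symmetric]) (use gA gi e in simp_all)
    also have "\<dots> = e" using gA e by (simp add: one_apply)
    finally have "\<phi> h e = e \<star> (g e \<star> e)" using h by (simp add: \<phi>_apply)
    also have "\<dots> = g e" using e gA aut_closed by (simp add: semisymmetric)
    finally have "\<phi> h = g" using Z_eqI[OF \<phi>Z[OF h] g e] by blast
    then have "\<phi> g \<odot> aut_inv (\<phi> (\<phi> g)) = g"
      unfolding h_def using g \<phi>Z mult \<phi>_mult \<phi>_inv by metis
    then have "\<phi> g = g \<odot> \<phi> (\<phi> g)" using g \<phi>Z Z_carrier by (metis A.inv_closed A.inv_solve_right A.inv_inv A.m_closed)
    also have "\<dots> = \<phi> (\<phi> g) \<odot> g" using GZ.m_comm[of g "\<phi> (\<phi> g)"] g \<phi>Z by (simp add: GZ_def)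
    finally show ?thesis by simp
  qed
  have "finite (carrier GZ)" using finite_subset[OF _ finite_aut] Z_carrier by (auto simp: GZ_def)
  moreover have "\<phi> \<in> hom GZ GZ" using \<phi>Z \<phi>_mult by (auto simp: hom_def GZ_def)
  ultimately have "even (multiplicity q (order GZ))"
    by (rule GZ.even_multiplicity_order) (use rel q in \<open>auto simp: GZ_def\<close>)
  then show ?thesis by (simp add: GZ_def order_def)
qed

theorem even_multiplicity_card:
  assumes "V \<noteq> {}" and q: "prime q" "[q = 2] (mod 3)"
  shows "even (multiplicity q (card V))"
proof -
  obtain n where n: "card V = 3 ^ n * card Z" using card_V assms(1) by blast
  have "card Z \<noteq> 0" using n finite_V assms(1) by auto
  \<comment> \<open>Since \<open>q\<close> is 2 modulo 3 it differs from 3, so the quotient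
    contributes nothing to the exponent.\<close>
  have "\<not> q dvd 3 ^ n"
  proof
    assume "q dvd 3 ^ n"
    then have "q = 3" using q(1) prime_dvd_power[of q 3 n] primes_dvd_imp_eq[of q 3] by simp
    then show False using q(2) by (simp add: cong_def)
  qed
  then have "multiplicity q (card V) = multiplicity q (card Z)"
    unfolding n using \<open>card Z \<noteq> 0\<close> q(1)
    by (simp add: prime_elem_multiplicity_mult_distrib not_dvd_imp_multiplicity_0)
  then show ?thesis using even_multiplicity_card_Z[OF assms] by simp
qed

end

section \<open>Reading off the exponent in the given factorization\<close>

lemma multiplicity_prod_other_primes:
  fixes p r :: "'b \<Rightarrow> nat"
  assumes "finite I" "prime x" "\<And>i. i \<in> I \<Longrightarrow> prime (p i)" "\<And>i. i \<in> I \<Longrightarrow> p i \<noteq> x"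
  shows "multiplicity x (\<Prod>i\<in>I. p i ^ r i) = 0"
proof (rule not_dvd_imp_multiplicity_0)
  have "\<not> x dvd p i ^ r i" if i: "i \<in> I" for i
  proof
    assume "x dvd p i ^ r i"
    then have "x dvd p i" using assms(2) prime_dvd_power by blast
    then show False using assms(2) assms(3,4)[OF i] primes_dvd_imp_eq by metis
  qed
  then show "\<not> x dvd (\<Prod>i\<in>I. p i ^ r i)" using assms(1,2) by (simp add: prime_dvd_prod_iff)
qed

theorem theorem2p10:
  fixes a b v :: nat and p q r s :: "nat \<Rightarrow> nat"
  assumes "v = (\<Prod>i\<in>{1..a}. p i ^ r i) * (\<Prod>j\<in>{1..b}. q j ^ s j)"
    and "\<And>i. i \<in> {1..a} \<Longrightarrow> prime (p i)"
    and "\<And>j. j \<in> {1..b} \<Longrightarrow> prime (q j)"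
    and "inj_on p {1..a}" and "inj_on q {1..b}"
    and "p ` {1..a} \<inter> q ` {1..b} = {}"
    and "\<And>i. i \<in> {1..a} \<Longrightarrow> [p i = 1] (mod 6) \<or> p i = 3"
    and "\<And>j. j \<in> {1..b} \<Longrightarrow> [q j = 2] (mod 3)"
    and "\<exists>j\<in>{1..b}. odd (s j)"
  shows "\<not> (\<exists>(V :: 'a set) comp. distributive_mendelsohn_quasigroup V comp \<and> card V = v)"
proof
  assume "\<exists>(V :: 'a set) comp. distributive_mendelsohn_quasigroup V comp \<and> card V = v"
  then obtain V :: "'a set" and comp where V: "distributive_mendelsohn_quasigroup V comp" "card V = v" by blast
  obtain j where j: "j \<in> {1..b}" "odd (s j)" using assms(9) by blast
  have qj: "prime (q j)" using assms(3) j by blast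
  let ?P = "\<Prod>i\<in>{1..a}. p i ^ r i" and ?Q = "\<Prod>i\<in>{1..b} - {j}. q i ^ s i"
  have "(\<Prod>i\<in>{1..b}. q i ^ s i) = q j ^ s j * ?Q" using j(1) by (intro prod.remove) auto
  then have v: "v = ?P * (q j ^ s j * ?Q)" using assms(1) by simp
  have "p i \<noteq> q j" if "i \<in> {1..a}" for i using assms(6) j(1) that by blast
  then have "multiplicity (q j) ?P = 0"
    using assms(2) qj by (intro multiplicity_prod_other_primes) simp_all
  moreover have "multiplicity (q j) ?Q = 0"
    using assms(3,5) j(1) qj by (intro multiplicity_prod_other_primes) (auto dest: inj_onD)
  moreover have nz: "?P \<noteq> 0" "?Q \<noteq> 0" "q j \<noteq> 0"
  proof -
    have "p i \<noteq> 0" if "i \<in> {1..a}" for i using assms(2)[OF that] by auto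
    then show "?P \<noteq> 0" by auto
    have q0: "q i \<noteq> 0" if "i \<in> {1..b}" for i using assms(3)[OF that] by auto
    then show "?Q \<noteq> 0" by auto
    show "q j \<noteq> 0" by (rule q0[OF j(1)])
  qed
  ultimately have mult: "multiplicity (q j) v = s j"
    unfolding v using qj by (simp add: prime_elem_multiplicity_mult_distrib)
  have "v \<noteq> 0" unfolding v using nz by simp
  \<comment> \<open>\<open>card\<close> is 0 on infinite sets and on the empty set, so a nonzero
    order excludes both.\<close>
  then have "finite V" "V \<noteq> {}" using V(2) card_ge_0_finite[of V] by auto
  then interpret finite_distributive_mendelsohn_quasigroup V comp
    using V(1) by (intro finite_distributive_mendelsohn_quasigroup.intro)
      (auto simp: finite_distributive_mendelsohn_quasigroup_axioms_def)
  have "even (multiplicity (q j) (card V))"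
    using \<open>V \<noteq> {}\<close> qj assms(8)[OF j(1)] by (rule even_multiplicity_card)
  then show False using mult j(2) V(2) by simp
qed

end
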